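(* Let $G$ be a countable discrete infinite group, $X$ a compact Hausdorff space and $\alpha: G\curvearrowright X$ a minimal, topologically free continuous action. Suppose that there is no $G$-invariant regular Borel probability measure on $X$ and that $\alpha$ has dynamical comparison. Then the reduced crossed product $C(X)\rtimes_r G$ is purely infinite and simple.
   Context: Subequivalence: for a closed set $F\subset X$ and an open set $O\subset X$, write $F\prec O$ if there exist a finite collection $\mathcal{U}$ of open subsets of $X$ covering $F$ and elements $s_U\in G$ ($U\in\mathcal{U}$) such that the sets $s_UU$, $U\in\mathcal{U}$, are pairwise disjoint subsets of $O$. For open $V,O$, write $V\prec O$ if $F\prec O$ for every closed $F\subset V$. The action has dynamical comparison if $V\prec O$ for every open $V\subset X$ and every nonempty open $O\subset X$ such that $\mu(V)<\mu(O)$ for all $G$-invariant regular Borel probability measures $\mu$ on $X$. The action is topologically free if $\{x\in X: tx=x\}$ has empty interior for every $t\neq e$. A $C^\ast$-algebra $A$ is purely infinite if it has no characters and for all positive $a,b\in A$ with $b$ in the closed ideal generated by $a$ one has $b\precsim a$, where $b\precsim a$ (Cuntz subequivalence) means there is a sequence $r_n$ with $r_n^\ast a r_n\to b$. *)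

theory Defs
  imports "HOL-Probability.Probability"
begin

definition group_action :: "('g::group_add \<Rightarrow> 'x::topological_space \<Rightarrow> 'x) \<Rightarrow> bool" where
  "group_action \<alpha> \<longleftrightarrow> (\<forall>g. continuous_on UNIV (\<alpha> g)) \<and> \<alpha> 0 = id \<and>
     (\<forall>g h. \<alpha> (g + h) = \<alpha> g \<circ> \<alpha> h)"

definition minimal_action :: "('g::group_add \<Rightarrow> 'x::topological_space \<Rightarrow> 'x) \<Rightarrow> bool" where
  "minimal_action \<alpha> \<longleftrightarrow> (\<forall>x. closure (range (\<lambda>g. \<alpha> g x)) = UNIV)"

definition topologically_free :: "('g::group_add \<Rightarrow> 'x::topological_space \<Rightarrow> 'x) \<Rightarrow> bool" where
  "topologically_free \<alpha> \<longleftrightarrow> (\<forall>t. t \<noteq> 0 \<longrightarrow> interior {x. \<alpha> t x = x} = {})"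

definition inv_reg_prob :: "('g \<Rightarrow> 'x::topological_space \<Rightarrow> 'x) \<Rightarrow> 'x measure \<Rightarrow> bool" where
  "inv_reg_prob \<alpha> \<mu> \<longleftrightarrow> sets \<mu> = sets borel \<and> prob_space \<mu> \<and>
     (\<forall>g A. A \<in> sets borel \<longrightarrow> emeasure \<mu> (\<alpha> g -` A) = emeasure \<mu> A) \<and>
     (\<forall>A \<in> sets borel.
        emeasure \<mu> A = (INF U \<in> {U. open U \<and> A \<subseteq> U}. emeasure \<mu> U) \<and>
        emeasure \<mu> A = (SUP K \<in> {K. compact K \<and> K \<subseteq> A}. emeasure \<mu> K))"

definition subequiv_closed :: "('g \<Rightarrow> 'x::topological_space \<Rightarrow> 'x) \<Rightarrow> 'x set \<Rightarrow> 'x set \<Rightarrow> bool" where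
  "subequiv_closed \<alpha> F Ob \<longleftrightarrow> (\<exists>Us s. finite Us \<and> (\<forall>U\<in>Us. open U) \<and> F \<subseteq> \<Union>Us \<and>
     (\<forall>U\<in>Us. \<alpha> (s U) ` U \<subseteq> Ob) \<and>
     (\<forall>U\<in>Us. \<forall>W\<in>Us. U \<noteq> W \<longrightarrow> \<alpha> (s U) ` U \<inter> \<alpha> (s W) ` W = {}))"

definition subequiv_open :: "('g \<Rightarrow> 'x::topological_space \<Rightarrow> 'x) \<Rightarrow> 'x set \<Rightarrow> 'x set \<Rightarrow> bool" where
  "subequiv_open \<alpha> V Ob \<longleftrightarrow> (\<forall>F. closed F \<and> F \<subseteq> V \<longrightarrow> subequiv_closed \<alpha> F Ob)"

definition dyn_comparison :: "('g \<Rightarrow> 'x::topological_space \<Rightarrow> 'x) \<Rightarrow> bool" where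
  "dyn_comparison \<alpha> \<longleftrightarrow> (\<forall>V Ob. open V \<and> open Ob \<and> Ob \<noteq> {} \<and>
     (\<forall>\<mu>. inv_reg_prob \<alpha> \<mu> \<longrightarrow> measure \<mu> V < measure \<mu> Ob) \<longrightarrow> subequiv_open \<alpha> V Ob)"

definition l2 :: "('i \<Rightarrow> complex) set" where
  "l2 = {\<xi>. (\<lambda>i. (cmod (\<xi> i))\<^sup>2) summable_on UNIV}"

definition l2norm :: "('i \<Rightarrow> complex) \<Rightarrow> real" where
  "l2norm \<xi> = sqrt (\<Sum>\<^sub>\<infinity>i. (cmod (\<xi> i))\<^sup>2)"

definition l2inner :: "('i \<Rightarrow> complex) \<Rightarrow> ('i \<Rightarrow> complex) \<Rightarrow> complex" where
  "l2inner \<xi> \<eta> = (\<Sum>\<^sub>\<infinity>i. cnj (\<xi> i) * \<eta> i)"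

type_synonym 'i op = "('i \<Rightarrow> complex) \<Rightarrow> ('i \<Rightarrow> complex)"

text \<open>Bounded linear operators on l2(I), represented as maps that vanish off l2(I).\<close>
definition bounded_op :: "'i op \<Rightarrow> bool" where
  "bounded_op T \<longleftrightarrow> (\<forall>\<xi>. \<xi> \<notin> l2 \<longrightarrow> T \<xi> = (\<lambda>i. 0)) \<and> (\<forall>\<xi>\<in>l2. T \<xi> \<in> l2) \<and>
     (\<forall>\<xi>\<in>l2. \<forall>\<eta>\<in>l2. \<forall>c. T (\<lambda>i. \<xi> i + c * \<eta> i) = (\<lambda>i. T \<xi> i + c * T \<eta> i)) \<and>
     (\<exists>C. \<forall>\<xi>\<in>l2. l2norm (T \<xi>) \<le> C * l2norm \<xi>)"

definition opnorm :: "'i op \<Rightarrow> real" where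
  "opnorm T = Sup {l2norm (T \<xi>) | \<xi>. \<xi> \<in> l2 \<and> l2norm \<xi> \<le> 1}"

definition adj :: "'i op \<Rightarrow> 'i op" where
  "adj T = (THE S. bounded_op S \<and> (\<forall>\<xi>\<in>l2. \<forall>\<eta>\<in>l2. l2inner (S \<xi>) \<eta> = l2inner \<xi> (T \<eta>)))"

definition op_zero :: "'i op" where "op_zero = (\<lambda>\<xi> i. 0)"
definition op_add :: "'i op \<Rightarrow> 'i op \<Rightarrow> 'i op" where "op_add S T = (\<lambda>\<xi> i. S \<xi> i + T \<xi> i)"
definition op_diff :: "'i op \<Rightarrow> 'i op \<Rightarrow> 'i op" where "op_diff S T = (\<lambda>\<xi> i. S \<xi> i - T \<xi> i)"
definition op_smul :: "complex \<Rightarrow> 'i op \<Rightarrow> 'i op" where "op_smul c T = (\<lambda>\<xi> i. c * T \<xi> i)"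

text \<open>Regular representation on l2(G \<times> X) induced from the faithful representation of C(X)
  by multiplication operators on l2(X): the generator  \<pi>(f) \<lambda>_g  acts by
  (\<pi>(f) \<lambda>_g \<xi>)(h,x) = f(h x) \<xi>(g\<inverse>h, x).\<close>
definition cp_gen :: "('g::group_add \<Rightarrow> 'x \<Rightarrow> 'x) \<Rightarrow> ('x \<Rightarrow> complex) \<Rightarrow> 'g \<Rightarrow> ('g \<times> 'x) op" where
  "cp_gen \<alpha> f g = (\<lambda>\<xi>. if \<xi> \<in> l2 then (\<lambda>(h, x). f (\<alpha> h x) * \<xi> (- g + h, x)) else (\<lambda>i. 0))"

definition cp_span :: "('g::group_add \<Rightarrow> 'x::topological_space \<Rightarrow> 'x) \<Rightarrow> ('g \<times> 'x) op set" where
  "cp_span \<alpha> = {S. \<exists>(n::nat) F gs. (\<forall>i<n. continuous_on UNIV (F i)) \<and>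
      S = (\<lambda>\<xi> j. \<Sum>i<n. cp_gen \<alpha> (F i) (gs i) \<xi> j)}"

definition crossed_product :: "('g::group_add \<Rightarrow> 'x::topological_space \<Rightarrow> 'x) \<Rightarrow> ('g \<times> 'x) op set" where
  "crossed_product \<alpha> = {T. bounded_op T \<and> (\<forall>\<epsilon>>0. \<exists>S\<in>cp_span \<alpha>. opnorm (op_diff T S) < \<epsilon>)}"

definition closed_ideal :: "'i op set \<Rightarrow> 'i op set \<Rightarrow> bool" where
  "closed_ideal A J \<longleftrightarrow> J \<subseteq> A \<and> op_zero \<in> J \<and> (\<forall>S\<in>J. \<forall>T\<in>J. op_add S T \<in> J) \<and>
     (\<forall>c. \<forall>S\<in>J. op_smul c S \<in> J) \<and> (\<forall>S\<in>J. \<forall>T\<in>A. S \<circ> T \<in> J \<and> T \<circ> S \<in> J) \<and>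
     (\<forall>T\<in>A. (\<forall>\<epsilon>>0. \<exists>S\<in>J. opnorm (op_diff T S) < \<epsilon>) \<longrightarrow> T \<in> J)"

definition ideal_gen :: "'i op set \<Rightarrow> 'i op \<Rightarrow> 'i op set" where
  "ideal_gen A a = \<Inter>{J. closed_ideal A J \<and> a \<in> J}"

definition simple_alg :: "'i op set \<Rightarrow> bool" where
  "simple_alg A \<longleftrightarrow> A \<noteq> {op_zero} \<and> (\<forall>J. closed_ideal A J \<longrightarrow> J = {op_zero} \<or> J = A)"

definition positive_el :: "'i op set \<Rightarrow> 'i op \<Rightarrow> bool" where
  "positive_el A a \<longleftrightarrow> a \<in> A \<and> (\<exists>c\<in>A. a = adj c \<circ> c)"

definition cuntz_below :: "'i op set \<Rightarrow> 'i op \<Rightarrow> 'i op \<Rightarrow> bool" where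
  "cuntz_below A b a \<longleftrightarrow> (\<exists>r. (\<forall>n. r n \<in> A) \<and>
     (\<lambda>n. opnorm (op_diff (adj (r n) \<circ> a \<circ> r n) b)) \<longlonglongrightarrow> 0)"

definition character :: "'i op set \<Rightarrow> ('i op \<Rightarrow> complex) \<Rightarrow> bool" where
  "character A \<phi> \<longleftrightarrow> (\<forall>S\<in>A. \<forall>T\<in>A. \<forall>c. \<phi> (op_add S (op_smul c T)) = \<phi> S + c * \<phi> T) \<and>
     (\<forall>S\<in>A. \<forall>T\<in>A. \<phi> (S \<circ> T) = \<phi> S * \<phi> T) \<and> (\<exists>S\<in>A. \<phi> S \<noteq> 0)"

definition purely_infinite :: "'i op set \<Rightarrow> bool" where
  "purely_infinite A \<longleftrightarrow> \<not> (\<exists>\<phi>. character A \<phi>) \<and>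
     (\<forall>a b. positive_el A a \<and> positive_el A b \<and> b \<in> ideal_gen A a \<longrightarrow> cuntz_below A b a)"

end

theory Submission
  imports Defs
begin

text \<open>Without invariant measures, comparison gives \<open>X \<prec> O\<close> for every nonempty open \<open>O\<close>. A
  partition of unity for the corresponding cover turns this into an element
  \<open>r = \<Sum>\<^sub>U \<lambda>(s\<^sub>U) k\<^sub>U\<close> with \<open>\<Sum>\<^sub>U k\<^sub>U\<^sup>2 = 1/m\<close>, a multiple of an isometry
  whose range lives over \<open>O\<close>. Let \<open>a = c\<^sup>* c \<noteq> 0\<close>. Its conditional expectation has a value \<open>m > 0\<close>
  at some point. Approximate \<open>a\<close> by a finite sum \<open>S\<close> and use topological freeness to choose \<open>O\<close> near
  that point so small that it is displaced by all nontrivial group elements occurring in \<open>S\<close> and the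
  diagonal of \<open>S\<close> is almost \<open>m\<close> on it. Then \<open>r\<^sup>* a r\<close> is close to \<open>1\<close>, which gives
  both simplicity and the Cuntz comparison. A character \<open>\<phi>\<close> would satisfy
  \<open>\<phi>(r\<^sup>* \<lambda>\<^sub>t r) \<noteq> 0\<close> although \<open>r\<^sup>* \<lambda>\<^sub>t r = 0\<close> as soon as \<open>t\<close> displaces \<open>O\<close>.\<close>

section \<open>Bounded operators on l2\<close>


definition basis_vec :: "'i \<Rightarrow> 'i \<Rightarrow> complex" where
  "basis_vec i = (\<lambda>j. if j = i then 1 else 0)"

definition truncate :: "'i set \<Rightarrow> ('i \<Rightarrow> complex) \<Rightarrow> 'i \<Rightarrow> complex" where
  "truncate F \<xi> = (\<lambda>i. if i \<in> F then \<xi> i else 0)"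

text \<open>Nonnegative terms with bounded finite partial sums are summable, with the same bound for
  the total. Norm estimates thereby reduce to finite sums, where the \<open>L2_set\<close>
  inequalities apply.\<close>

lemma l2_boundI:
  assumes "0 \<le> C" and "\<And>F. finite F \<Longrightarrow> (\<Sum>i\<in>F. (cmod (\<xi> i))\<^sup>2) \<le> C\<^sup>2"
  shows "\<xi> \<in> l2" and "l2norm \<xi> \<le> C"
proof -
  have s: "(\<lambda>i. (cmod (\<xi> i))\<^sup>2) summable_on UNIV"
    by (rule nonneg_bdd_above_summable_on) (auto intro!: bdd_aboveI[of _ "C\<^sup>2"] assms(2))
  then show "\<xi> \<in> l2" by (simp add: l2_def)
  have "(\<Sum>\<^sub>\<infinity>i. (cmod (\<xi> i))\<^sup>2) \<le> C\<^sup>2"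
    using s assms(2) by (rule infsum_le_finite_sums)
  then show "l2norm \<xi> \<le> C"
    unfolding l2norm_def using assms(1) by (simp add: real_le_lsqrt)
qed

lemma l2norm_nonneg: "0 \<le> l2norm \<xi>"
  by (simp add: l2norm_def infsum_nonneg)

lemma l2norm_power2: "(l2norm \<xi>)\<^sup>2 = (\<Sum>\<^sub>\<infinity>i. (cmod (\<xi> i))\<^sup>2)"
  by (simp add: l2norm_def infsum_nonneg)

lemma l2_finite_sum_le:
  assumes "\<xi> \<in> l2" "finite F"
  shows "(\<Sum>i\<in>F. (cmod (\<xi> i))\<^sup>2) \<le> (l2norm \<xi>)\<^sup>2"
  using assms finite_sum_le_infsum[of "\<lambda>i. (cmod (\<xi> i))\<^sup>2" UNIV F]
  by (simp add: l2_def l2norm_power2)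

lemma L2_set_le_l2norm:
  assumes "\<xi> \<in> l2" "finite F"
  shows "L2_set (\<lambda>i. cmod (\<xi> i)) F \<le> l2norm \<xi>"
  unfolding L2_set_def using l2_finite_sum_le[OF assms] by (simp add: real_le_lsqrt l2norm_nonneg)

text \<open>Minkowski's inequality for \<open>L2_set\<close> holds on each finite set, with a final
  bound that no longer depends on that set.\<close>

lemma l2_lincomb:
  assumes "\<xi> \<in> l2" "\<eta> \<in> l2"
  shows "(\<lambda>i. \<xi> i + c * \<eta> i) \<in> l2"
    and "l2norm (\<lambda>i. \<xi> i + c * \<eta> i) \<le> l2norm \<xi> + cmod c * l2norm \<eta>"
proof -
  have "(\<Sum>i\<in>F. (cmod (\<xi> i + c * \<eta> i))\<^sup>2) \<le> (l2norm \<xi> + cmod c * l2norm \<eta>)\<^sup>2" if F: "finite F" for F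
  proof -
    have "L2_set (\<lambda>i. cmod (\<xi> i + c * \<eta> i)) F \<le> L2_set (\<lambda>i. cmod (\<xi> i) + cmod c * cmod (\<eta> i)) F"
      by (rule L2_set_mono) (auto intro: order.trans[OF norm_triangle_ineq] simp: norm_mult)
    also have "\<dots> \<le> L2_set (\<lambda>i. cmod (\<xi> i)) F + L2_set (\<lambda>i. cmod c * cmod (\<eta> i)) F"
      by (rule L2_set_triangle_ineq)
    also have "L2_set (\<lambda>i. cmod c * cmod (\<eta> i)) F = cmod c * L2_set (\<lambda>i. cmod (\<eta> i)) F"
      by (simp add: L2_set_right_distrib)
    also have "L2_set (\<lambda>i. cmod (\<xi> i)) F + cmod c * L2_set (\<lambda>i. cmod (\<eta> i)) F
        \<le> l2norm \<xi> + cmod c * l2norm \<eta>"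
      using F assms by (intro add_mono mult_left_mono L2_set_le_l2norm) auto
    finally show ?thesis
      unfolding L2_set_def by (rule sqrt_le_D)
  qed
  note * = l2_boundI[OF _ this]
  show "(\<lambda>i. \<xi> i + c * \<eta> i) \<in> l2"
    and "l2norm (\<lambda>i. \<xi> i + c * \<eta> i) \<le> l2norm \<xi> + cmod c * l2norm \<eta>"
    by (rule *; simp add: l2norm_nonneg)+
qed

lemma zero_in_l2 [simp]: "(\<lambda>i. 0) \<in> l2"
  by (simp add: l2_def)

lemma l2norm_zero [simp]: "l2norm (\<lambda>i. 0) = 0"
  by (simp add: l2norm_def)

lemma l2_diff: "\<xi> \<in> l2 \<Longrightarrow> \<eta> \<in> l2 \<Longrightarrow> (\<lambda>i. \<xi> i - \<eta> i) \<in> l2"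
  using l2_lincomb(1)[of \<xi> \<eta> "-1"] by simp

lemma l2norm_triangle: "\<xi> \<in> l2 \<Longrightarrow> \<eta> \<in> l2 \<Longrightarrow> l2norm (\<lambda>i. \<xi> i + \<eta> i) \<le> l2norm \<xi> + l2norm \<eta>"
  using l2_lincomb(2)[of \<xi> \<eta> 1] by simp

lemma l2_cmult: "\<xi> \<in> l2 \<Longrightarrow> (\<lambda>i. c * \<xi> i) \<in> l2"
  using l2_lincomb(1)[of "\<lambda>i. 0" \<xi> c] by simp

lemma l2norm_cmult: "l2norm (\<lambda>i. c * \<xi> i) = cmod c * l2norm \<xi>"
  by (simp add: l2norm_def norm_mult power_mult_distrib infsum_cmult_right' real_sqrt_mult)

lemma component_le_l2norm: "\<xi> \<in> l2 \<Longrightarrow> cmod (\<xi> i) \<le> l2norm \<xi>"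
  using L2_set_le_l2norm[of \<xi> "{i}"] by simp

lemma l2norm_eq_0_iff: "\<xi> \<in> l2 \<Longrightarrow> l2norm \<xi> = 0 \<longleftrightarrow> \<xi> = (\<lambda>i. 0)"
  using component_le_l2norm[of \<xi>] by (fastforce simp: l2norm_def)

lemma basis_vec_in_l2 [simp]: "basis_vec i \<in> l2"
  and l2norm_basis_vec [simp]: "l2norm (basis_vec i) = 1"
proof -
  have "((\<lambda>j. (cmod (basis_vec i j))\<^sup>2) has_sum (\<Sum>j\<in>{i}. (cmod (basis_vec i j))\<^sup>2)) UNIV"
    by (rule has_sum_finite_neutralI[of "{i}"]) (auto simp: basis_vec_def)
  then have "((\<lambda>j. (cmod (basis_vec i j))\<^sup>2) has_sum 1) UNIV"
    by (simp add: basis_vec_def)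
  then show "basis_vec i \<in> l2" "l2norm (basis_vec i) = 1"
    by (auto simp: l2_def l2norm_def infsumI summable_on_def)
qed

lemma truncate_in_l2:
  assumes "\<xi> \<in> l2"
  shows "truncate F \<xi> \<in> l2"
proof (rule l2_boundI(1)[OF l2norm_nonneg])
  show "(\<Sum>i\<in>H. (cmod (truncate F \<xi> i))\<^sup>2) \<le> (l2norm \<xi>)\<^sup>2" if "finite H" for H
    by (rule order.trans[OF sum_mono l2_finite_sum_le[OF assms that]]) (simp add: truncate_def)
qed

lemma truncate_insert:
  "i \<notin> F \<Longrightarrow> truncate (insert i F) \<xi> = (\<lambda>j. truncate F \<xi> j + \<xi> i * basis_vec i j)"
  by (auto simp: truncate_def basis_vec_def)

text \<open>A finite partial sum that comes within \<open>\<epsilon>\<^sup>2\<close> of the total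
  leaves a tail of squared norm at most \<open>\<epsilon>\<^sup>2\<close>. This carries identities
  from finitely supported vectors to all of l2.\<close>

lemma truncate_approx:
  assumes "\<xi> \<in> l2" "0 < \<epsilon>"
  obtains F where "finite F" "l2norm (\<lambda>i. \<xi> i - truncate F \<xi> i) \<le> \<epsilon>"
proof -
  let ?f = "\<lambda>i. (cmod (\<xi> i))\<^sup>2"
  have "\<exists>F. finite F \<and> sum ?f F > infsum ?f UNIV - \<epsilon>\<^sup>2"
  proof (rule ccontr)
    assume "\<not> ?thesis"
    then have "infsum ?f UNIV \<le> infsum ?f UNIV - \<epsilon>\<^sup>2"
      using assms(1) by (intro infsum_le_finite_sums) (auto simp: l2_def not_less)
    then show False using assms(2) by simp
  qed
  then obtain F where F: "finite F" "sum ?f F > infsum ?f UNIV - \<epsilon>\<^sup>2" by blast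
  have "(\<Sum>i\<in>H. (cmod (\<xi> i - truncate F \<xi> i))\<^sup>2) \<le> \<epsilon>\<^sup>2" if H: "finite H" for H
  proof -
    have "(\<Sum>i\<in>H. (cmod (\<xi> i - truncate F \<xi> i))\<^sup>2) = sum ?f (H - F)"
      by (rule sum.mono_neutral_cong_right) (auto simp: truncate_def H)
    also have "\<dots> = sum ?f (H \<union> F) - sum ?f F"
      using sum.subset_diff[of F "H \<union> F" ?f] H F(1) by (simp add: Un_Diff)
    also have "\<dots> \<le> \<epsilon>\<^sup>2"
      using l2_finite_sum_le[OF assms(1), of "H \<union> F"] H F by (simp add: l2norm_power2)
    finally show ?thesis .
  qed
  from l2_boundI(2)[OF _ this] assms(2) F(1) that show thesis by simp
qed

text \<open>Cauchy-Schwarz on finite sets bounds the partial sums of absolute values, so absolute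
  summability and the bound on the inner product come from one estimate.\<close>

lemma l2inner_bound:
  assumes "\<xi> \<in> l2" "\<eta> \<in> l2"
  shows "(\<lambda>i. cmod (cnj (\<xi> i) * \<eta> i)) summable_on UNIV"
    and "cmod (l2inner \<xi> \<eta>) \<le> l2norm \<xi> * l2norm \<eta>"
proof -
  have b: "(\<Sum>i\<in>F. cmod (cnj (\<xi> i) * \<eta> i)) \<le> l2norm \<xi> * l2norm \<eta>" if F: "finite F" for F
  proof -
    have "(\<Sum>i\<in>F. cmod (cnj (\<xi> i) * \<eta> i)) = (\<Sum>i\<in>F. \<bar>cmod (\<xi> i)\<bar> * \<bar>cmod (\<eta> i)\<bar>)"
      by (simp add: norm_mult)
    also have "\<dots> \<le> L2_set (\<lambda>i. cmod (\<xi> i)) F * L2_set (\<lambda>i. cmod (\<eta> i)) F"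
      by (rule L2_set_mult_ineq)
    also have "\<dots> \<le> l2norm \<xi> * l2norm \<eta>"
      using F assms by (intro mult_mono L2_set_le_l2norm) (auto simp: l2norm_nonneg)
    finally show ?thesis .
  qed
  show s: "(\<lambda>i. cmod (cnj (\<xi> i) * \<eta> i)) summable_on UNIV"
    by (rule nonneg_bdd_above_summable_on)
       (use b in \<open>auto intro!: bdd_aboveI[of _ "l2norm \<xi> * l2norm \<eta>"]\<close>)
  have "cmod (l2inner \<xi> \<eta>) \<le> (\<Sum>\<^sub>\<infinity>i. cmod (cnj (\<xi> i) * \<eta> i))"
    unfolding l2inner_def using s by (rule norm_infsum_bound)
  also have "\<dots> \<le> l2norm \<xi> * l2norm \<eta>"
    using s b by (rule infsum_le_finite_sums)
  finally show "cmod (l2inner \<xi> \<eta>) \<le> l2norm \<xi> * l2norm \<eta>" .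
qed

lemma l2inner_lincomb_right:
  assumes "\<xi> \<in> l2" "\<eta> \<in> l2" "\<zeta> \<in> l2"
  shows "l2inner \<xi> (\<lambda>i. \<eta> i + c * \<zeta> i) = l2inner \<xi> \<eta> + c * l2inner \<xi> \<zeta>"
proof -
  have "(\<lambda>i. cnj (\<xi> i) * \<eta> i) summable_on UNIV" "(\<lambda>i. cnj (\<xi> i) * \<zeta> i) summable_on UNIV"
    using assms by (simp_all add: abs_summable_summable[OF l2inner_bound(1)])
  then have "(\<Sum>\<^sub>\<infinity>i. cnj (\<xi> i) * \<eta> i + c * (cnj (\<xi> i) * \<zeta> i)) = l2inner \<xi> \<eta> + c * l2inner \<xi> \<zeta>"
    unfolding l2inner_def
    by (subst infsum_add) (auto intro!: summable_on_cmult_right simp: infsum_cmult_right')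
  then show ?thesis by (simp add: l2inner_def algebra_simps)
qed

lemma l2inner_cnj: "cnj (l2inner \<xi> \<eta>) = l2inner \<eta> \<xi>"
  by (simp add: l2inner_def mult.commute flip: infsum_cnj)

lemma l2inner_zero_left [simp]: "l2inner (\<lambda>i. 0) \<xi> = 0"
  by (simp add: l2inner_def)

lemma l2inner_lincomb_left:
  assumes "\<xi> \<in> l2" "\<eta> \<in> l2" "\<zeta> \<in> l2"
  shows "l2inner (\<lambda>i. \<eta> i + c * \<zeta> i) \<xi> = l2inner \<eta> \<xi> + cnj c * l2inner \<zeta> \<xi>"
  using arg_cong[OF l2inner_lincomb_right[OF assms, of c], of cnj] by (simp add: l2inner_cnj)

lemma l2inner_self:
  assumes "\<xi> \<in> l2"
  shows "l2inner \<xi> \<xi> = of_real ((l2norm \<xi>)\<^sup>2)"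
proof -
  have "((\<lambda>i. (cmod (\<xi> i))\<^sup>2) has_sum (l2norm \<xi>)\<^sup>2) UNIV"
    using assms by (simp add: l2_def l2norm_power2)
  then have "((\<lambda>i. of_real ((cmod (\<xi> i))\<^sup>2)) has_sum complex_of_real ((l2norm \<xi>)\<^sup>2)) UNIV"
    by (simp only: has_sum_of_real_iff)
  moreover have "complex_of_real ((cmod (\<xi> i))\<^sup>2) = cnj (\<xi> i) * \<xi> i" for i
    by (metis complex_norm_square mult.commute)
  ultimately show ?thesis by (simp add: l2inner_def infsumI)
qed

lemma l2inner_basis_right: "l2inner \<xi> (basis_vec i) = cnj (\<xi> i)"
proof -
  have "((\<lambda>j. cnj (\<xi> j) * basis_vec i j) has_sum (\<Sum>j\<in>{i}. cnj (\<xi> j) * basis_vec i j)) UNIV"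
    by (rule has_sum_finite_neutralI[of "{i}"]) (auto simp: basis_vec_def)
  then show ?thesis by (simp add: l2inner_def infsumI basis_vec_def)
qed

section \<open>Bounded operators and the operator norm\<close>

lemma bounded_op_off: "bounded_op T \<Longrightarrow> \<xi> \<notin> l2 \<Longrightarrow> T \<xi> = (\<lambda>i. 0)"
  and bounded_op_in_l2: "bounded_op T \<Longrightarrow> T \<xi> \<in> l2"
  and bounded_op_lincomb: "bounded_op T \<Longrightarrow> \<xi> \<in> l2 \<Longrightarrow> \<eta> \<in> l2 \<Longrightarrow>
    T (\<lambda>i. \<xi> i + c * \<eta> i) = (\<lambda>i. T \<xi> i + c * T \<eta> i)"
  by (cases "\<xi> \<in> l2"; simp add: bounded_op_def)+

lemma bounded_op_zero_arg: "bounded_op T \<Longrightarrow> T (\<lambda>i. 0) = (\<lambda>i. 0)"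
  using bounded_op_lincomb[of T "\<lambda>i. 0" "\<lambda>i. 0" "-1"] by simp

lemma bounded_opI:
  assumes "\<And>\<xi>. \<xi> \<notin> l2 \<Longrightarrow> T \<xi> = (\<lambda>i. 0)" "\<And>\<xi>. \<xi> \<in> l2 \<Longrightarrow> T \<xi> \<in> l2"
    "\<And>\<xi> \<eta> c i. \<xi> \<in> l2 \<Longrightarrow> \<eta> \<in> l2 \<Longrightarrow> T (\<lambda>i. \<xi> i + c * \<eta> i) i = T \<xi> i + c * T \<eta> i"
    "\<And>\<xi>. \<xi> \<in> l2 \<Longrightarrow> l2norm (T \<xi>) \<le> C * l2norm \<xi>"
  shows "bounded_op T"
  unfolding bounded_op_def
  by (intro conjI exI[of _ C] ballI allI impI ext) (use assms in auto)

lemma bounded_op_add: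
  assumes "bounded_op S" "bounded_op T"
  shows "bounded_op (\<lambda>\<xi> i. S \<xi> i + c * T \<xi> i)"
proof -
  obtain C D where CD: "\<And>\<xi>. \<xi> \<in> l2 \<Longrightarrow> l2norm (S \<xi>) \<le> C * l2norm \<xi>"
      "\<And>\<xi>. \<xi> \<in> l2 \<Longrightarrow> l2norm (T \<xi>) \<le> D * l2norm \<xi>"
    using assms unfolding bounded_op_def by metis
  show ?thesis
  proof (rule bounded_opI)
    fix \<xi> :: "'a \<Rightarrow> complex" assume \<xi>: "\<xi> \<in> l2"
    have "l2norm (\<lambda>i. S \<xi> i + c * T \<xi> i) \<le> l2norm (S \<xi>) + cmod c * l2norm (T \<xi>)"
      using assms by (intro l2_lincomb bounded_op_in_l2)
    also have "\<dots> \<le> C * l2norm \<xi> + cmod c * (D * l2norm \<xi>)"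
      using CD \<xi> by (intro add_mono mult_left_mono) auto
    finally show "l2norm (\<lambda>i. S \<xi> i + c * T \<xi> i) \<le> (C + cmod c * D) * l2norm \<xi>"
      by (simp add: algebra_simps)
  qed (use assms in \<open>auto simp: bounded_op_off bounded_op_lincomb bounded_op_in_l2 algebra_simps
        intro!: l2_lincomb\<close>)
qed

lemma bounded_op_zero [simp]: "bounded_op op_zero"
  by (rule bounded_opI[where C = 0]) (auto simp: op_zero_def)

lemma bounded_op_op_add: "bounded_op S \<Longrightarrow> bounded_op T \<Longrightarrow> bounded_op (op_add S T)"
  using bounded_op_add[of S T 1] by (simp add: op_add_def)

lemma bounded_op_diff: "bounded_op S \<Longrightarrow> bounded_op T \<Longrightarrow> bounded_op (op_diff S T)"
  using bounded_op_add[of S T "-1"] by (simp add: op_diff_def)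

text \<open>Rescaling a nonzero \<open>\<xi>\<close> to norm 1 places it in the unit ball over which
  \<open>opnorm T\<close> is the supremum. That supremum is meaningful because boundedness of
  \<open>T\<close> bounds the set above.\<close>

lemma l2norm_le_opnorm:
  assumes "bounded_op T" "\<xi> \<in> l2"
  shows "l2norm (T \<xi>) \<le> opnorm T * l2norm \<xi>"
proof (cases "l2norm \<xi> = 0")
  case True
  then show ?thesis using assms by (simp add: l2norm_eq_0_iff bounded_op_zero_arg)
next
  case False
  then have pos: "0 < l2norm \<xi>" using l2norm_nonneg[of \<xi>] by linarith
  obtain C where C: "\<And>\<xi>. \<xi> \<in> l2 \<Longrightarrow> l2norm (T \<xi>) \<le> C * l2norm \<xi>"
    using assms(1) unfolding bounded_op_def by metis
  have bdd: "bdd_above {l2norm (T \<xi>) | \<xi>. \<xi> \<in> l2 \<and> l2norm \<xi> \<le> 1}"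
  proof (rule bdd_aboveI, safe)
    fix \<xi> :: "'a \<Rightarrow> complex" assume \<xi>: "\<xi> \<in> l2" "l2norm \<xi> \<le> 1"
    \<comment> \<open>No sign of \<open>C\<close> has been established, hence the absolute
      value.\<close>
    have "l2norm (T \<xi>) \<le> \<bar>C\<bar> * l2norm \<xi>"
      by (rule order.trans[OF C[OF \<xi>(1)]]) (simp add: l2norm_nonneg mult_right_mono)
    also have "\<dots> \<le> \<bar>C\<bar>" using \<xi>(2) by (simp add: mult_left_le)
    finally show "l2norm (T \<xi>) \<le> \<bar>C\<bar>" .
  qed
  define c :: complex where "c = of_real (1 / l2norm \<xi>)"
  have "T (\<lambda>i. c * \<xi> i) = (\<lambda>i. c * T \<xi> i)"
    using bounded_op_lincomb[OF assms(1) zero_in_l2 assms(2), of c] assms(1)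
    by (simp add: bounded_op_zero_arg)
  then have "cmod c * l2norm (T \<xi>) = l2norm (T (\<lambda>i. c * \<xi> i))"
    by (simp add: l2norm_cmult)
  also have "\<dots> \<le> opnorm T"
  proof -
    have "l2norm (\<lambda>i. c * \<xi> i) \<le> 1"
      unfolding l2norm_cmult using pos by (simp add: c_def norm_divide)
    then show ?thesis
      unfolding opnorm_def using l2_cmult[OF assms(2), of c] by (intro cSup_upper bdd) blast
  qed
  finally show ?thesis using pos by (simp add: c_def norm_divide field_simps)
qed

lemma opnorm_le:
  assumes "0 \<le> C" "\<And>\<xi>. \<xi> \<in> l2 \<Longrightarrow> l2norm (T \<xi>) \<le> C * l2norm \<xi>"
  shows "opnorm T \<le> C"
  unfolding opnorm_def
proof (rule cSup_least)
  show "{l2norm (T \<xi>) |\<xi>. \<xi> \<in> l2 \<and> l2norm \<xi> \<le> 1} \<noteq> {}"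
    by (auto intro!: exI[of _ "\<lambda>i. 0"])
next
  fix y assume "y \<in> {l2norm (T \<xi>) |\<xi>. \<xi> \<in> l2 \<and> l2norm \<xi> \<le> 1}"
  then obtain \<xi> where \<xi>: "\<xi> \<in> l2" "l2norm \<xi> \<le> 1" "y = l2norm (T \<xi>)" by auto
  show "y \<le> C"
    using assms(2)[OF \<xi>(1)] mult_left_mono[OF \<xi>(2) assms(1)] \<xi>(3) by simp
qed

lemma opnorm_nonneg: "bounded_op T \<Longrightarrow> 0 \<le> opnorm T"
  using l2norm_le_opnorm[of T "basis_vec undefined"] l2norm_nonneg[of "T (basis_vec undefined)"] by simp

lemma opnorm_zero [simp]: "opnorm op_zero = 0"
proof (rule antisym)
  show "opnorm op_zero \<le> 0" by (rule opnorm_le) (simp_all add: op_zero_def)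
qed (simp add: opnorm_nonneg)

text \<open>Matrix entries are continuous in the operator norm; through this estimate they can be
  compared with those of approximants in the span.\<close>

lemma entry_le_opnorm: "bounded_op T \<Longrightarrow> cmod (T (basis_vec j) i) \<le> opnorm T"
  using l2norm_le_opnorm[of T "basis_vec j"] component_le_l2norm[OF bounded_op_in_l2, of T "basis_vec j" i]
  by simp

lemma opnorm_add_le:
  assumes "bounded_op S" "bounded_op T"
  shows "opnorm (op_add S T) \<le> opnorm S + opnorm T"
proof (rule opnorm_le)
  fix \<xi> :: "'a \<Rightarrow> complex" assume \<xi>: "\<xi> \<in> l2"
  have "l2norm (op_add S T \<xi>) \<le> l2norm (S \<xi>) + l2norm (T \<xi>)"
    unfolding op_add_def using assms by (intro l2norm_triangle bounded_op_in_l2)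
  also have "\<dots> \<le> opnorm S * l2norm \<xi> + opnorm T * l2norm \<xi>"
    using assms \<xi> by (intro add_mono l2norm_le_opnorm)
  finally show "l2norm (op_add S T \<xi>) \<le> (opnorm S + opnorm T) * l2norm \<xi>"
    by (simp add: algebra_simps)
qed (use assms in \<open>simp add: opnorm_nonneg\<close>)

lemma bounded_op_comp:
  assumes "bounded_op S" "bounded_op T"
  shows "bounded_op (S \<circ> T)" and "opnorm (S \<circ> T) \<le> opnorm S * opnorm T"
proof -
  have b: "l2norm ((S \<circ> T) \<xi>) \<le> opnorm S * opnorm T * l2norm \<xi>" if "\<xi> \<in> l2" for \<xi>
  proof -
    have "l2norm ((S \<circ> T) \<xi>) \<le> opnorm S * l2norm (T \<xi>)"
      using assms by (simp add: l2norm_le_opnorm bounded_op_in_l2)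
    also have "\<dots> \<le> opnorm S * (opnorm T * l2norm \<xi>)"
      using assms that by (intro mult_left_mono l2norm_le_opnorm opnorm_nonneg)
    finally show ?thesis by (simp add: mult.assoc)
  qed
  show "bounded_op (S \<circ> T)"
    by (rule bounded_opI[OF _ _ _ b])
       (use assms in \<open>auto simp: bounded_op_off bounded_op_zero_arg bounded_op_in_l2 bounded_op_lincomb\<close>)
  show "opnorm (S \<circ> T) \<le> opnorm S * opnorm T"
    by (rule opnorm_le[OF _ b]) (use assms in \<open>auto simp: opnorm_nonneg\<close>)
qed

lemma opnorm_diff_commute: "opnorm (op_diff S T) = opnorm (op_diff T S)"
proof -
  have "l2norm (op_diff S T \<xi>) = l2norm (op_diff T S \<xi>)" for \<xi>
    by (simp add: op_diff_def l2norm_def norm_minus_commute)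
  then show ?thesis by (simp add: opnorm_def)
qed

text \<open>Finite combinations of basis vectors are dense, and continuity extends
  \<open>D = 0\<close> from them to l2. Off l2 both operators vanish by convention, so they agree as
  functions.\<close>

lemma bounded_op_ext:
  assumes "bounded_op S" "bounded_op T" "\<And>i. S (basis_vec i) = T (basis_vec i)"
  shows "S = T"
proof -
  define D where "D = op_diff S T"
  have D: "bounded_op D" unfolding D_def using assms by (intro bounded_op_diff)
  have Db: "D (basis_vec i) = (\<lambda>i. 0)" for i by (simp add: D_def op_diff_def assms)
  have "D \<xi> = (\<lambda>i. 0)" if \<xi>: "\<xi> \<in> l2" for \<xi>
  proof -
    have trunc: "D (truncate F \<xi>) = (\<lambda>i. 0)" if "finite F" for F
      using that
    proof induction
      case empty
      then show ?case using D by (simp add: truncate_def bounded_op_zero_arg)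
    next
      case (insert i F)
      then show ?case
        using D \<xi> by (simp add: truncate_insert bounded_op_lincomb truncate_in_l2 Db)
    qed
    have "l2norm (D \<xi>) \<le> 0 + e" if e: "0 < e" for e
    proof -
      \<comment> \<open>The summand 1 keeps the denominator positive when \<open>opnorm D\<close> is
        0.\<close>
      define d where "d = e / (opnorm D + 1)"
      have d: "0 < d" using e opnorm_nonneg[OF D] by (simp add: d_def)
      obtain F where F: "finite F" "l2norm (\<lambda>i. \<xi> i - truncate F \<xi> i) \<le> d"
        using truncate_approx[OF \<xi> d] .
      have "D (\<lambda>i. \<xi> i - truncate F \<xi> i) = D \<xi>"
        using bounded_op_lincomb[OF D \<xi> truncate_in_l2[OF \<xi>], of "-1" F] trunc[OF F(1)] by simp
      then have "l2norm (D \<xi>) \<le> opnorm D * l2norm (\<lambda>i. \<xi> i - truncate F \<xi> i)"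
        using l2norm_le_opnorm[OF D l2_diff[OF \<xi> truncate_in_l2[OF \<xi>]], of F] by simp
      also have "\<dots> \<le> opnorm D * d"
        using F(2) D by (intro mult_left_mono opnorm_nonneg)
      also have "\<dots> \<le> e"
        using opnorm_nonneg[OF D] e by (simp add: d_def field_simps)
      finally show ?thesis by simp
    qed
    then have "l2norm (D \<xi>) \<le> 0" by (rule field_le_epsilon)
    then have "l2norm (D \<xi>) = 0" using l2norm_nonneg[of "D \<xi>"] by linarith
    then show ?thesis by (simp add: l2norm_eq_0_iff bounded_op_in_l2 D)
  qed
  then have "D \<xi> = (\<lambda>i. 0)" for \<xi> using bounded_op_off[OF D] by blast
  then show ?thesis by (simp add: D_def op_diff_def fun_eq_iff)
qed

section \<open>Adjoints\<close>

lemma adj_eqI: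
  assumes "bounded_op S" "\<And>\<xi> \<eta>. \<xi> \<in> l2 \<Longrightarrow> \<eta> \<in> l2 \<Longrightarrow> l2inner (S \<xi>) \<eta> = l2inner \<xi> (T \<eta>)"
  shows "adj T = S"
  unfolding adj_def
proof (rule the_equality)
  fix S' assume S': "bounded_op S' \<and> (\<forall>\<xi>\<in>l2. \<forall>\<eta>\<in>l2. l2inner (S' \<xi>) \<eta> = l2inner \<xi> (T \<eta>))"
  \<comment> \<open>The definite description also demands uniqueness: pairing with basis vectors
    recovers every coordinate, so two candidates agree on the basis.\<close>
  show "S' = S"
  proof (rule bounded_op_ext)
    fix i
    have "l2inner (S' (basis_vec i)) (basis_vec j) = l2inner (S (basis_vec i)) (basis_vec j)" for j
      using S' assms(2) by simp
    then show "S' (basis_vec i) = S (basis_vec i)"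
      by (simp add: l2inner_basis_right fun_eq_iff)
  qed (use S' assms in auto)
qed (use assms in auto)

text \<open>The defining relation tested on basis vectors forces coordinate \<open>i\<close> of
  \<open>S \<xi>\<close> to be the inner product of \<open>T (basis_vec i)\<close> with
  \<open>\<xi>\<close>. The work lies in showing that this family is square-summable and that the
  relation extends from truncations to all \<open>\<eta>\<close>.\<close>

lemma adjoint_exists:
  assumes T: "bounded_op T"
  obtains S where "bounded_op S"
    "\<And>\<xi> \<eta>. \<xi> \<in> l2 \<Longrightarrow> \<eta> \<in> l2 \<Longrightarrow> l2inner (S \<xi>) \<eta> = l2inner \<xi> (T \<eta>)"
proof -
  define S where "S = (\<lambda>\<xi>. if \<xi> \<in> l2 then (\<lambda>i. l2inner (T (basis_vec i)) \<xi>) else (\<lambda>i. 0))"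
  have trunc_sum: "l2inner (T (truncate F \<zeta>)) \<xi> = (\<Sum>i\<in>F. cnj (\<zeta> i) * S \<xi> i)"
    if "finite F" "\<zeta> \<in> l2" "\<xi> \<in> l2" for F \<zeta> \<xi>
    using that(1)
  proof induction
    case empty
    then show ?case using T
      by (simp add: truncate_def bounded_op_zero_arg)
  next
    case (insert i F)
    then show ?case using T that(2,3)
      by (simp add: truncate_insert bounded_op_lincomb truncate_in_l2 l2inner_lincomb_left
          bounded_op_in_l2 S_def)
  qed
  have S_bound: "(\<Sum>i\<in>F. (cmod (S \<xi> i))\<^sup>2) \<le> (opnorm T * l2norm \<xi>)\<^sup>2"
    if F: "finite F" and \<xi>: "\<xi> \<in> l2" for F \<xi>
  proof -
    \<comment> \<open>Testing against the truncation of \<open>S \<xi>\<close> itself turns the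
      pairing into the sum of squares \<open>?s\<close>. This gives
      \<open>?s \<le> sqrt ?s * (opnorm T * l2norm \<xi>)\<close>, where one factor
      \<open>sqrt ?s\<close> cancels.\<close>
    define \<zeta> where "\<zeta> = truncate F (S \<xi>)"
    let ?s = "\<Sum>i\<in>F. (cmod (S \<xi> i))\<^sup>2"
    have s0: "0 \<le> ?s" by (simp add: sum_nonneg)
    have "(\<Sum>i\<in>H. (cmod (\<zeta> i))\<^sup>2) \<le> (sqrt ?s)\<^sup>2" if H: "finite H" for H
    proof -
      have "(\<Sum>i\<in>H. (cmod (\<zeta> i))\<^sup>2) = (\<Sum>i\<in>H \<inter> F. (cmod (S \<xi> i))\<^sup>2)"
        by (rule sum.mono_neutral_cong_right) (auto simp: H \<zeta>_def truncate_def)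
      also have "\<dots> \<le> ?s" using F by (intro sum_mono2) auto
      finally show ?thesis using s0 by simp
    qed
    from l2_boundI[OF _ this] s0 have \<zeta>: "\<zeta> \<in> l2" "l2norm \<zeta> \<le> sqrt ?s" by auto
    have "of_real ?s = (\<Sum>i\<in>F. cnj (\<zeta> i) * S \<xi> i)"
      by (simp add: \<zeta>_def truncate_def complex_norm_square mult.commute flip: of_real_power)
    also have "\<dots> = l2inner (T \<zeta>) \<xi>"
    proof -
      have "truncate F \<zeta> = \<zeta>" by (simp add: \<zeta>_def truncate_def fun_eq_iff)
      then show ?thesis using trunc_sum[OF F \<zeta>(1) \<xi>] by simp
    qed
    finally have "?s = cmod (l2inner (T \<zeta>) \<xi>)"
      using s0 by (metis norm_of_real abs_of_nonneg)
    also have "\<dots> \<le> l2norm (T \<zeta>) * l2norm \<xi>"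
      using \<xi> T by (simp add: l2inner_bound bounded_op_in_l2)
    also have "\<dots> \<le> (opnorm T * sqrt ?s) * l2norm \<xi>"
      by (intro mult_right_mono order.trans[OF l2norm_le_opnorm[OF T \<zeta>(1)]] mult_left_mono
          \<zeta>(2) opnorm_nonneg T l2norm_nonneg)
    finally have *: "?s \<le> sqrt ?s * (opnorm T * l2norm \<xi>)" by (simp add: mult_ac)
    have "sqrt ?s \<le> opnorm T * l2norm \<xi>"
    proof (cases "?s = 0")
      case False
      then have "0 < sqrt ?s" using s0 by (metis real_sqrt_gt_zero less_eq_real_def)
      moreover have "sqrt ?s * sqrt ?s \<le> sqrt ?s * (opnorm T * l2norm \<xi>)" using * s0 by simp
      ultimately show ?thesis by (simp only: mult_le_cancel_left_pos)
    qed (use T in \<open>simp add: opnorm_nonneg l2norm_nonneg\<close>)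
    then show ?thesis by (rule sqrt_le_D)
  qed
  have nn: "0 \<le> opnorm T * l2norm \<xi>" for \<xi>
    using T by (simp add: opnorm_nonneg l2norm_nonneg)
  have S: "S \<xi> \<in> l2" "l2norm (S \<xi>) \<le> opnorm T * l2norm \<xi>" if "\<xi> \<in> l2" for \<xi>
    using l2_boundI[OF nn S_bound[OF _ that]] by auto
  have bS: "bounded_op S"
  proof (rule bounded_opI)
    show "S (\<lambda>i. \<xi> i + c * \<eta> i) i = S \<xi> i + c * S \<eta> i" if "\<xi> \<in> l2" "\<eta> \<in> l2" for \<xi> \<eta> c i
      using that T by (simp add: S_def l2_lincomb l2inner_lincomb_right bounded_op_in_l2)
  qed (use S in \<open>auto simp: S_def\<close>)
  have adjS: "l2inner (S \<xi>) \<eta> = l2inner \<xi> (T \<eta>)" if \<xi>: "\<xi> \<in> l2" and \<eta>: "\<eta> \<in> l2" for \<xi> \<eta>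
  proof -
    have trunc: "l2inner (S \<xi>) (truncate F \<eta>) = l2inner \<xi> (T (truncate F \<eta>))" if F: "finite F" for F
    proof -
      have "((\<lambda>i. cnj (S \<xi> i) * truncate F \<eta> i) has_sum (\<Sum>i\<in>F. cnj (S \<xi> i) * truncate F \<eta> i)) UNIV"
        by (rule has_sum_finite_neutralI[of F]) (auto simp: truncate_def F)
      then have "l2inner (S \<xi>) (truncate F \<eta>) = (\<Sum>i\<in>F. cnj (S \<xi> i) * \<eta> i)"
        by (simp add: l2inner_def infsumI truncate_def)
      also have "\<dots> = cnj (l2inner (T (truncate F \<eta>)) \<xi>)"
        unfolding trunc_sum[OF F \<eta> \<xi>] by (simp add: mult.commute)
      finally show ?thesis by (simp add: l2inner_cnj)
    qed
    have "cmod (l2inner (S \<xi>) \<eta> - l2inner \<xi> (T \<eta>)) \<le> 0 + e" if e: "0 < e" for e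
    proof -
      \<comment> \<open>Each of the two error terms is at most
        \<open>opnorm T * l2norm \<xi>\<close> times the norm of the tail, which accounts for the
        factor 2; the summand 1 keeps \<open>K\<close> positive.\<close>
      define K where "K = 2 * (opnorm T * l2norm \<xi>) + 1"
      have K: "0 < K" using nn[of \<xi>] by (simp add: K_def)
      define d where "d = e / K"
      have d: "0 < d" using e K by (simp add: d_def)
      obtain F where F: "finite F" "l2norm (\<lambda>i. \<eta> i - truncate F \<eta> i) \<le> d"
        using truncate_approx[OF \<eta> d] .
      define \<zeta> where "\<zeta> = (\<lambda>i. \<eta> i - truncate F \<eta> i)"
      have t: "truncate F \<eta> \<in> l2" using \<eta> by (rule truncate_in_l2)
      have \<zeta>: "\<zeta> \<in> l2" "l2norm \<zeta> \<le> d" unfolding \<zeta>_def using F \<eta> t by (auto intro: l2_diff)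
      have \<zeta>_eq: "\<zeta> = (\<lambda>i. \<eta> i + (-1) * truncate F \<eta> i)" by (simp add: \<zeta>_def)
      have "l2inner (S \<xi>) \<eta> - l2inner \<xi> (T \<eta>) = l2inner (S \<xi>) \<zeta> - l2inner \<xi> (T \<zeta>)"
        unfolding \<zeta>_eq bounded_op_lincomb[OF T \<eta> t] l2inner_lincomb_right[OF S(1)[OF \<xi>] \<eta> t]
          l2inner_lincomb_right[OF \<xi> bounded_op_in_l2[OF T] bounded_op_in_l2[OF T]]
        by (simp add: trunc[OF F(1)])
      also have "cmod \<dots> \<le> cmod (l2inner (S \<xi>) \<zeta>) + cmod (l2inner \<xi> (T \<zeta>))"
        by (rule norm_triangle_ineq4)
      also have "\<dots> \<le> l2norm (S \<xi>) * l2norm \<zeta> + l2norm \<xi> * l2norm (T \<zeta>)"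
        using \<zeta>(1) by (intro add_mono l2inner_bound S(1) \<xi> bounded_op_in_l2[OF T])
      also have "\<dots> \<le> (opnorm T * l2norm \<xi>) * l2norm \<zeta> + l2norm \<xi> * (opnorm T * l2norm \<zeta>)"
        using S(2)[OF \<xi>] \<zeta>(1) T
        by (intro add_mono mult_right_mono mult_left_mono l2norm_le_opnorm l2norm_nonneg)
      also have "\<dots> = (K - 1) * l2norm \<zeta>" by (simp add: K_def)
      also have "\<dots> \<le> K * d"
        using \<zeta>(2) K by (intro mult_mono) (auto simp: l2norm_nonneg)
      also have "\<dots> = e" using K by (simp add: d_def)
      finally show ?thesis by simp
    qed
    then have "cmod (l2inner (S \<xi>) \<eta> - l2inner \<xi> (T \<eta>)) \<le> 0" by (rule field_le_epsilon)
    then show ?thesis by simp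
  qed
  show thesis
  proof (rule that)
    show "bounded_op S" by (fact bS)
  qed (rule adjS)
qed

lemma
  assumes T: "bounded_op T"
  shows adj_bounded: "bounded_op (adj T)"
    and adj_inner: "\<xi> \<in> l2 \<Longrightarrow> \<eta> \<in> l2 \<Longrightarrow> l2inner (adj T \<xi>) \<eta> = l2inner \<xi> (T \<eta>)"
proof -
  obtain S where S: "bounded_op S"
    "\<And>\<xi> \<eta>. \<xi> \<in> l2 \<Longrightarrow> \<eta> \<in> l2 \<Longrightarrow> l2inner (S \<xi>) \<eta> = l2inner \<xi> (T \<eta>)"
    using adjoint_exists[OF T] by blast
  have "adj T = S" by (rule adj_eqI) (simp_all add: S)
  then show "bounded_op (adj T)"
    and "\<xi> \<in> l2 \<Longrightarrow> \<eta> \<in> l2 \<Longrightarrow> l2inner (adj T \<xi>) \<eta> = l2inner \<xi> (T \<eta>)"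
    using S by simp_all
qed

text \<open>For \<open>\<zeta> = adj T \<xi>\<close> the squared norm of \<open>\<zeta>\<close> is
  the inner product of \<open>\<xi>\<close> with \<open>T \<zeta>\<close>. Cauchy-Schwarz bounds it
  by \<open>opnorm T * l2norm \<xi> * l2norm \<zeta>\<close>, and a factor
  \<open>l2norm \<zeta>\<close> cancels.\<close>

lemma opnorm_adj_le:
  assumes T: "bounded_op T"
  shows "opnorm (adj T) \<le> opnorm T"
proof (rule opnorm_le)
  fix \<xi> :: "'a \<Rightarrow> complex" assume \<xi>: "\<xi> \<in> l2"
  define \<zeta> where "\<zeta> = adj T \<xi>"
  have \<zeta>: "\<zeta> \<in> l2" using adj_bounded[OF T] by (simp add: \<zeta>_def bounded_op_in_l2)
  have "of_real ((l2norm \<zeta>)\<^sup>2) = l2inner \<xi> (T \<zeta>)"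
    using adj_inner[OF T \<xi> \<zeta>] l2inner_self[OF \<zeta>] by (simp add: \<zeta>_def)
  then have "(l2norm \<zeta>)\<^sup>2 = cmod (l2inner \<xi> (T \<zeta>))"
    by (metis norm_of_real abs_of_nonneg zero_le_power2)
  also have "\<dots> \<le> l2norm \<xi> * l2norm (T \<zeta>)"
    using \<xi> T by (simp add: l2inner_bound bounded_op_in_l2)
  also have "\<dots> \<le> l2norm \<xi> * (opnorm T * l2norm \<zeta>)"
    using \<zeta> T by (intro mult_left_mono l2norm_le_opnorm l2norm_nonneg)
  finally have *: "l2norm \<zeta> * l2norm \<zeta> \<le> l2norm \<zeta> * (opnorm T * l2norm \<xi>)"
    by (simp add: power2_eq_square mult_ac)
  show "l2norm (adj T \<xi>) \<le> opnorm T * l2norm \<xi>"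
  proof (cases "l2norm \<zeta> = 0")
    case False
    then have "0 < l2norm \<zeta>" using l2norm_nonneg[of \<zeta>] by linarith
    with * show ?thesis by (simp add: \<zeta>_def)
  qed (use T in \<open>simp add: \<zeta>_def opnorm_nonneg l2norm_nonneg\<close>)
qed (use T in \<open>simp add: opnorm_nonneg\<close>)

lemma adj_lincomb:
  assumes "bounded_op S" "bounded_op T"
  shows "adj (\<lambda>\<xi> i. S \<xi> i + c * T \<xi> i) = (\<lambda>\<xi> i. adj S \<xi> i + cnj c * adj T \<xi> i)"
  by (rule adj_eqI)
     (use assms in \<open>simp_all add: bounded_op_add adj_bounded l2inner_lincomb_left l2inner_lincomb_right
       bounded_op_in_l2 adj_inner\<close>)

lemma adj_op_add: "bounded_op S \<Longrightarrow> bounded_op T \<Longrightarrow> adj (op_add S T) = op_add (adj S) (adj T)"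
  using adj_lincomb[of S T 1] by (simp add: op_add_def)

lemma adj_op_diff: "bounded_op S \<Longrightarrow> bounded_op T \<Longrightarrow> adj (op_diff S T) = op_diff (adj S) (adj T)"
  using adj_lincomb[of S T "-1"] by (simp add: op_diff_def)

lemma adj_comp:
  "bounded_op S \<Longrightarrow> bounded_op T \<Longrightarrow> adj (S \<circ> T) = adj T \<circ> adj S"
  by (rule adj_eqI) (simp_all add: bounded_op_comp adj_bounded adj_inner bounded_op_in_l2)

text \<open>Linearity of \<open>R\<close> is available only on l2, and boundedness of
  \<open>S\<close> and \<open>T\<close> places their values there. For composition on the right, the
  corresponding law holds by unfolding.\<close>

lemma comp_op_add:
  "bounded_op R \<Longrightarrow> bounded_op S \<Longrightarrow> bounded_op T \<Longrightarrow> R \<circ> op_add S T = op_add (R \<circ> S) (R \<circ> T)"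
  using bounded_op_lincomb[of R "S _" "T _" 1] by (simp add: op_add_def fun_eq_iff bounded_op_in_l2)

lemma comp_op_diff:
  "bounded_op R \<Longrightarrow> bounded_op S \<Longrightarrow> bounded_op T \<Longrightarrow> R \<circ> op_diff S T = op_diff (R \<circ> S) (R \<circ> T)"
  using bounded_op_lincomb[of R "S _" "T _" "-1"] by (simp add: op_diff_def fun_eq_iff bounded_op_in_l2)

lemma comp_op_zero: "bounded_op R \<Longrightarrow> R \<circ> op_zero = op_zero"
  by (simp add: op_zero_def fun_eq_iff bounded_op_zero_arg)

lemma adj_op_zero: "adj op_zero = op_zero"
  by (rule adj_eqI) (simp_all, simp_all add: op_zero_def l2inner_def)

section \<open>The reduced crossed product\<close>


locale compact_group_action =
  fixes \<alpha> :: "'g::group_add \<Rightarrow> 'x::t2_space \<Rightarrow> 'x"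
  assumes compact_UNIV: "compact (UNIV :: 'x set)"
    and action: "group_action \<alpha>"
begin

lemma act_continuous: "continuous_on UNIV (\<alpha> g)"
  and act_zero [simp]: "\<alpha> 0 x = x"
  and act_add: "\<alpha> (g + h) x = \<alpha> g (\<alpha> h x)"
  using action by (auto simp: group_action_def)

lemma act_minus_cancel [simp]: "\<alpha> (- g) (\<alpha> g x) = x" "\<alpha> g (\<alpha> (- g) x) = x"
  by (simp_all flip: act_add)

lemma continuous_act [continuous_intros]:
  "continuous_on UNIV f \<Longrightarrow> continuous_on UNIV (\<lambda>y. f (\<alpha> g y))"
  using continuous_on_compose2[of UNIV f UNIV "\<alpha> g"] act_continuous by auto

lemma cp_gen_apply: "\<xi> \<in> l2 \<Longrightarrow> cp_gen \<alpha> f g \<xi> (h, x) = f (\<alpha> h x) * \<xi> (- g + h, x)"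
  by (simp add: cp_gen_def)

lemma cp_gen_off: "\<xi> \<notin> l2 \<Longrightarrow> cp_gen \<alpha> f g \<xi> = (\<lambda>i. 0)"
  by (simp add: cp_gen_def)

text \<open>The matrix of a generator has entries only from \<open>(h, x)\<close> to
  \<open>(g + h, x)\<close>: it moves along the group and fixes the point \<open>x\<close>. Addition
  is the group law here and need not commute.\<close>

lemma cp_gen_basis:
  "cp_gen \<alpha> f g (basis_vec (h, x)) (k, y) = (if - g + k = h \<and> y = x then f (\<alpha> k y) else 0)"
  unfolding cp_gen_apply[OF basis_vec_in_l2] by (simp add: basis_vec_def)

text \<open>A generator permutes the coordinates by left translation and then multiplies by a
  bounded function. Only a pointwise bound on \<open>f\<close> enters, so multipliers whose
  continuity has not been established are covered too.\<close>

lemma cp_gen_bound: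
  fixes f :: "'x \<Rightarrow> complex"
  assumes B: "\<And>y. cmod (f y) \<le> B"
  shows "bounded_op (cp_gen \<alpha> f g)" and "opnorm (cp_gen \<alpha> f g) \<le> B"
proof -
  have B0: "0 \<le> B" using B[of undefined] norm_ge_zero order.trans by blast
  define \<tau> where "\<tau> = (\<lambda>(h, x::'x). (- g + h, x))"
  have inj: "inj_on \<tau> H" for H by (auto simp: inj_on_def \<tau>_def)
  have app: "cp_gen \<alpha> f g \<xi> p = f (\<alpha> (fst p) (snd p)) * \<xi> (\<tau> p)" if "\<xi> \<in> l2" for \<xi> p
    using that by (cases p) (simp add: cp_gen_apply \<tau>_def)
  have "(\<Sum>p\<in>H. (cmod (cp_gen \<alpha> f g \<xi> p))\<^sup>2) \<le> (B * l2norm \<xi>)\<^sup>2" if \<xi>: "\<xi> \<in> l2" and H: "finite H" for \<xi> H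
  proof -
    have "(\<Sum>p\<in>H. (cmod (cp_gen \<alpha> f g \<xi> p))\<^sup>2) \<le> (\<Sum>p\<in>H. B\<^sup>2 * (cmod (\<xi> (\<tau> p)))\<^sup>2)"
      by (intro sum_mono) (auto simp: app[OF \<xi>] norm_mult power_mult_distrib
          intro!: mult_right_mono power_mono B)
    also have "\<dots> = B\<^sup>2 * (\<Sum>q\<in>\<tau> ` H. (cmod (\<xi> q))\<^sup>2)"
      by (simp add: sum.reindex[OF inj] sum_distrib_left)
    also have "\<dots> \<le> B\<^sup>2 * (l2norm \<xi>)\<^sup>2"
      using H by (intro mult_left_mono l2_finite_sum_le \<xi>) auto
    finally show ?thesis by (simp add: power_mult_distrib)
  qed
  from l2_boundI[OF _ this] have bd: "cp_gen \<alpha> f g \<xi> \<in> l2" "l2norm (cp_gen \<alpha> f g \<xi>) \<le> B * l2norm \<xi>"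
    if "\<xi> \<in> l2" for \<xi>
    using that B0 by (simp_all add: l2norm_nonneg)
  show "bounded_op (cp_gen \<alpha> f g)"
    by (rule bounded_opI[OF _ bd(1) _ bd(2)])
       (auto simp: app l2_lincomb cp_gen_off algebra_simps)
  show "opnorm (cp_gen \<alpha> f g) \<le> B"
    using B0 bd(2) by (rule opnorm_le)
qed

lemma cp_gen_bounded:
  assumes "continuous_on UNIV f"
  shows "bounded_op (cp_gen \<alpha> f g)"
proof -
  have "bounded (range f)"
    using assms compact_UNIV by (intro compact_imp_bounded compact_continuous_image)
  then obtain B where "\<And>y. cmod (f y) \<le> B" by (auto simp: bounded_iff)
  then show ?thesis by (rule cp_gen_bound)
qed

text \<open>Reindexing the inner product by left translation moves the translation to the other
  argument; the coefficient is then evaluated at \<open>\<alpha> g y\<close>.\<close>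

lemma adj_cp_gen:
  assumes f: "continuous_on UNIV f"
  shows "adj (cp_gen \<alpha> f g) = cp_gen \<alpha> (\<lambda>y. cnj (f (\<alpha> g y))) (- g)"
proof (rule adj_eqI)
  show "bounded_op (cp_gen \<alpha> (\<lambda>y. cnj (f (\<alpha> g y))) (- g))"
    using f by (intro cp_gen_bounded continuous_on_cnj continuous_act)
  fix \<xi> \<eta> :: "'g \<times> 'x \<Rightarrow> complex" assume l2: "\<xi> \<in> l2" "\<eta> \<in> l2"
  define \<tau> where "\<tau> = (\<lambda>(h, x::'x). (g + h, x))"
  have "bij_betw \<tau> UNIV UNIV"
    by (rule bij_betwI[of _ _ _ "\<lambda>(h, x). (- g + h, x)"]) (auto simp: \<tau>_def simp flip: add.assoc)
  then have "l2inner \<xi> (cp_gen \<alpha> f g \<eta>) = (\<Sum>\<^sub>\<infinity>p. cnj (\<xi> (\<tau> p)) * cp_gen \<alpha> f g \<eta> (\<tau> p))"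
    unfolding l2inner_def
    by (rule infsum_reindex_bij_betw[symmetric, where f = "\<lambda>p. cnj (\<xi> p) * cp_gen \<alpha> f g \<eta> p"])
  also have "\<dots> = l2inner (cp_gen \<alpha> (\<lambda>y. cnj (f (\<alpha> g y))) (- g) \<xi>) \<eta>"
    unfolding l2inner_def
    by (rule infsum_cong) (auto simp: \<tau>_def cp_gen_apply l2 act_add simp flip: add.assoc)
  finally show "l2inner (cp_gen \<alpha> (\<lambda>y. cnj (f (\<alpha> g y))) (- g) \<xi>) \<eta> = l2inner \<xi> (cp_gen \<alpha> f g \<eta>)" ..
qed

text \<open>Covariance: moving a translation by \<open>g\<close> past multiplication by
  \<open>f'\<close> replaces \<open>f'\<close> by \<open>f' \<circ> \<alpha> (- g)\<close>.
  Continuity of \<open>f'\<close> ensures that the intermediate vector lies in l2 and is not sent to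
  0 by convention.\<close>

lemma cp_gen_comp:
  assumes "continuous_on UNIV f'"
  shows "cp_gen \<alpha> f g \<circ> cp_gen \<alpha> f' g' = cp_gen \<alpha> (\<lambda>y. f y * f' (\<alpha> (- g) y)) (g + g')"
proof (intro ext, clarify)
  fix \<xi> :: "'g \<times> 'x \<Rightarrow> complex" and h x
  have "cp_gen \<alpha> f' g' \<xi> \<in> l2" using assms by (intro bounded_op_in_l2 cp_gen_bounded)
  then show "(cp_gen \<alpha> f g \<circ> cp_gen \<alpha> f' g') \<xi> (h, x) =
      cp_gen \<alpha> (\<lambda>y. f y * f' (\<alpha> (- g) y)) (g + g') \<xi> (h, x)"
    by (cases "\<xi> \<in> l2")
       (simp_all add: cp_gen_apply cp_gen_off act_add minus_add add.assoc del: add_uminus_conv_diff)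
qed

lemma cp_span_zero: "op_zero \<in> cp_span \<alpha>"
  by (auto simp: cp_span_def op_zero_def intro!: exI[of _ "0::nat"])

lemma cp_span_add_gen:
  assumes "S \<in> cp_span \<alpha>" "continuous_on UNIV f"
  shows "op_add S (cp_gen \<alpha> f g) \<in> cp_span \<alpha>"
proof -
  obtain n :: nat and F gs where F: "\<forall>i<n. continuous_on UNIV (F i)"
    "S = (\<lambda>\<xi> j. \<Sum>i<n. cp_gen \<alpha> (F i) (gs i) \<xi> j)"
    using assms(1) unfolding cp_span_def by blast
  have "op_add S (cp_gen \<alpha> f g) =
      (\<lambda>\<xi> j. \<Sum>i<Suc n. cp_gen \<alpha> ((F(n := f)) i) ((gs(n := g)) i) \<xi> j)"
    by (simp add: op_add_def F(2))
  moreover have "\<forall>i<Suc n. continuous_on UNIV ((F(n := f)) i)"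
    using F(1) assms(2) by (simp add: less_Suc_eq)
  ultimately show ?thesis unfolding cp_span_def by blast
qed

lemma cp_span_induct [consumes 1, case_names zero add_gen]:
  assumes "S \<in> cp_span \<alpha>" "P op_zero"
    and step: "\<And>S f g. S \<in> cp_span \<alpha> \<Longrightarrow> P S \<Longrightarrow> continuous_on UNIV f \<Longrightarrow> P (op_add S (cp_gen \<alpha> f g))"
  shows "P S"
proof -
  obtain n :: nat and F gs where F: "\<forall>i<n. continuous_on UNIV (F i)"
    "S = (\<lambda>\<xi> j. \<Sum>i<n. cp_gen \<alpha> (F i) (gs i) \<xi> j)"
    using assms(1) unfolding cp_span_def by blast
  \<comment> \<open>Membership in the span is carried along, because \<open>step\<close> requires it
    of the partial sum.\<close>
  have "P (\<lambda>\<xi> j. \<Sum>i<m. cp_gen \<alpha> (F i) (gs i) \<xi> j) \<and>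
      (\<lambda>\<xi> j. \<Sum>i<m. cp_gen \<alpha> (F i) (gs i) \<xi> j) \<in> cp_span \<alpha>" if "m \<le> n" for m
    using that
  proof (induction m)
    case 0
    then show ?case using assms(2) cp_span_zero by (simp add: op_zero_def)
  next
    case (Suc m)
    then show ?case
      using step[of "\<lambda>\<xi> j. \<Sum>i<m. cp_gen \<alpha> (F i) (gs i) \<xi> j" "F m" "gs m"]
        cp_span_add_gen[of "\<lambda>\<xi> j. \<Sum>i<m. cp_gen \<alpha> (F i) (gs i) \<xi> j" "F m" "gs m"] F(1)
      by (simp add: op_add_def)
  qed
  then show ?thesis using F(2) by blast
qed

lemma cp_span_gen: "continuous_on UNIV f \<Longrightarrow> cp_gen \<alpha> f g \<in> cp_span \<alpha>"
  using cp_span_add_gen[OF cp_span_zero, of f g] by (simp add: op_add_def op_zero_def)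

lemma cp_span_add:
  assumes "S \<in> cp_span \<alpha>" "T \<in> cp_span \<alpha>"
  shows "op_add S T \<in> cp_span \<alpha>"
  using assms(2)
proof (induction rule: cp_span_induct)
  case zero
  then show ?case using assms(1) by (simp add: op_add_def op_zero_def)
next
  case (add_gen T f g)
  have "op_add S (op_add T (cp_gen \<alpha> f g)) = op_add (op_add S T) (cp_gen \<alpha> f g)"
    by (simp add: op_add_def add.assoc)
  then show ?case using add_gen by (simp add: cp_span_add_gen)
qed

lemma cp_span_sum:
  assumes "finite I" "\<And>i. i \<in> I \<Longrightarrow> continuous_on UNIV (f i)"
  shows "(\<lambda>\<xi> j. \<Sum>i\<in>I. cp_gen \<alpha> (f i) (s i) \<xi> j) \<in> cp_span \<alpha>"
  using assms
proof (induction rule: finite_induct)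
  case empty
  then show ?case using cp_span_zero by (simp add: op_zero_def)
next
  case (insert i I)
  then show ?case
    using cp_span_add[OF cp_span_gen[of "f i" "s i"], of "\<lambda>\<xi> j. \<Sum>i\<in>I. cp_gen \<alpha> (f i) (s i) \<xi> j"]
    by (simp add: op_add_def)
qed

lemma cp_span_bounded: "S \<in> cp_span \<alpha> \<Longrightarrow> bounded_op S"
  by (induction rule: cp_span_induct) (auto intro: bounded_op_op_add cp_gen_bounded)

lemma cp_span_adj: "S \<in> cp_span \<alpha> \<Longrightarrow> adj S \<in> cp_span \<alpha>"
proof (induction rule: cp_span_induct)
  case zero
  show ?case by (simp add: adj_op_zero cp_span_zero)
next
  case (add_gen S f g)
  then show ?case
    by (auto simp: adj_op_add cp_span_bounded cp_gen_bounded adj_cp_gen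
        intro!: cp_span_add_gen continuous_on_cnj continuous_act)
qed

lemma adj_sum_cp_gen:
  assumes "finite I" "\<And>i. i \<in> I \<Longrightarrow> continuous_on UNIV (f i)"
  shows "adj (\<lambda>\<xi> j. \<Sum>i\<in>I. cp_gen \<alpha> (f i) (s i) \<xi> j) =
    (\<lambda>\<xi> j. \<Sum>i\<in>I. cp_gen \<alpha> (\<lambda>y. cnj (f i (\<alpha> (s i) y))) (- s i) \<xi> j)"
  using assms
proof (induction rule: finite_induct)
  case empty
  then show ?case using adj_op_zero by (simp add: op_zero_def)
next
  case (insert i I)
  let ?S = "\<lambda>\<xi> j. \<Sum>i\<in>I. cp_gen \<alpha> (f i) (s i) \<xi> j"
  have "(\<lambda>\<xi> j. \<Sum>i\<in>insert i I. cp_gen \<alpha> (f i) (s i) \<xi> j) = op_add (cp_gen \<alpha> (f i) (s i)) ?S"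
    using insert by (simp add: op_add_def)
  moreover have "adj (op_add (cp_gen \<alpha> (f i) (s i)) ?S) = op_add (adj (cp_gen \<alpha> (f i) (s i))) (adj ?S)"
    using insert by (intro adj_op_add cp_gen_bounded cp_span_bounded cp_span_sum) auto
  ultimately show ?case using insert by (simp add: adj_cp_gen op_add_def)
qed

lemma cp_span_comp:
  assumes "S \<in> cp_span \<alpha>" "T \<in> cp_span \<alpha>"
  shows "S \<circ> T \<in> cp_span \<alpha>"
  using assms(1)
proof (induction rule: cp_span_induct)
  case zero
  have "op_zero \<circ> T = op_zero" by (simp add: op_zero_def fun_eq_iff)
  then show ?case by (simp add: cp_span_zero)
next
  case (add_gen S f g)
  have "cp_gen \<alpha> f g \<circ> T \<in> cp_span \<alpha>"
    using assms(2)
  proof (induction rule: cp_span_induct)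
    case zero
    show ?case
      unfolding comp_op_zero[OF cp_gen_bounded[OF \<open>continuous_on UNIV f\<close>]] by (rule cp_span_zero)
  next
    case (add_gen T f' g')
    have "cp_gen \<alpha> f g \<circ> op_add T (cp_gen \<alpha> f' g') = op_add (cp_gen \<alpha> f g \<circ> T) (cp_gen \<alpha> f g \<circ> cp_gen \<alpha> f' g')"
      using add_gen \<open>continuous_on UNIV f\<close>
      by (intro comp_op_add cp_gen_bounded cp_span_bounded)
    also have "\<dots> \<in> cp_span \<alpha>"
      unfolding cp_gen_comp[OF add_gen(2)]
      by (intro cp_span_add_gen add_gen continuous_intros \<open>continuous_on UNIV f\<close>)
    finally show ?case .
  qed
  moreover have "op_add S (cp_gen \<alpha> f g) \<circ> T = op_add (S \<circ> T) (cp_gen \<alpha> f g \<circ> T)"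
    by (simp add: op_add_def fun_eq_iff)
  ultimately show ?case using cp_span_add[OF add_gen(3)] by metis
qed

section \<open>The norm closure and its algebra structure\<close>

lemma crossed_product_bounded: "T \<in> crossed_product \<alpha> \<Longrightarrow> bounded_op T"
  by (simp add: crossed_product_def)

lemma crossed_product_approx:
  assumes "T \<in> crossed_product \<alpha>" "0 < \<epsilon>"
  obtains S where "S \<in> cp_span \<alpha>" "opnorm (op_diff T S) < \<epsilon>"
  using assms by (auto simp: crossed_product_def)

lemma cp_span_subset: "S \<in> cp_span \<alpha> \<Longrightarrow> S \<in> crossed_product \<alpha>"
proof -
  assume S: "S \<in> cp_span \<alpha>"
  have "op_diff S S = op_zero" by (simp add: op_diff_def op_zero_def)
  then show ?thesis
    using S cp_span_bounded[OF S] unfolding crossed_product_def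
    by (auto intro!: bexI[of _ S])
qed

lemma crossed_product_adj:
  assumes T: "T \<in> crossed_product \<alpha>"
  shows "adj T \<in> crossed_product \<alpha>"
  unfolding crossed_product_def
proof (intro CollectI conjI allI impI)
  note bT = crossed_product_bounded[OF T]
  then show "bounded_op (adj T)" by (rule adj_bounded)
  fix \<epsilon> :: real assume "0 < \<epsilon>"
  then obtain S where S: "S \<in> cp_span \<alpha>" "opnorm (op_diff T S) < \<epsilon>"
    using crossed_product_approx[OF T] by blast
  have bS: "bounded_op S" using S(1) by (rule cp_span_bounded)
  have "opnorm (op_diff (adj T) (adj S)) \<le> opnorm (op_diff T S)"
    using opnorm_adj_le[OF bounded_op_diff[OF bT bS]] by (simp add: adj_op_diff bT bS)
  then show "\<exists>S\<in>cp_span \<alpha>. opnorm (op_diff (adj T) S) < \<epsilon>"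
    using S cp_span_adj[OF S(1)] by (intro bexI[of _ "adj S"]) auto
qed

lemma crossed_product_comp:
  assumes T: "T \<in> crossed_product \<alpha>" and T': "T' \<in> crossed_product \<alpha>"
  shows "T \<circ> T' \<in> crossed_product \<alpha>"
  unfolding crossed_product_def
proof (intro CollectI conjI allI impI)
  note bT = crossed_product_bounded[OF T] and bT' = crossed_product_bounded[OF T']
  then show "bounded_op (T \<circ> T')" by (rule bounded_op_comp)
  fix \<epsilon> :: real assume \<epsilon>: "0 < \<epsilon>"
  define \<delta>' where "\<delta>' = \<epsilon> / (2 * (opnorm T + 1))"
  have \<delta>': "0 < \<delta>'" using \<epsilon> opnorm_nonneg[OF bT] by (simp add: \<delta>'_def)
  obtain S' where S': "S' \<in> cp_span \<alpha>" "opnorm (op_diff T' S') < \<delta>'"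
    using crossed_product_approx[OF T' \<delta>'] .
  have bS': "bounded_op S'" using S'(1) by (rule cp_span_bounded)
  \<comment> \<open>\<open>S'\<close> is fixed before \<open>S\<close>, since the accuracy demanded
    of \<open>S\<close> depends on the norm of \<open>S'\<close> through the error
    \<open>op_diff T S \<circ> S'\<close>.\<close>
  define \<delta> where "\<delta> = \<epsilon> / (2 * (opnorm S' + 1))"
  have \<delta>: "0 < \<delta>" using \<epsilon> opnorm_nonneg[OF bS'] by (simp add: \<delta>_def)
  obtain S where S: "S \<in> cp_span \<alpha>" "opnorm (op_diff T S) < \<delta>"
    using crossed_product_approx[OF T \<delta>] .
  have bS: "bounded_op S" using S(1) by (rule cp_span_bounded)
  have "op_diff (T \<circ> T') (S \<circ> S') = op_add (T \<circ> op_diff T' S') (op_diff T S \<circ> S')"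
    unfolding comp_op_diff[OF bT bT' bS'] by (simp add: op_add_def op_diff_def fun_eq_iff)
  then have "opnorm (op_diff (T \<circ> T') (S \<circ> S')) \<le> opnorm (T \<circ> op_diff T' S') + opnorm (op_diff T S \<circ> S')"
    using bT bT' bS bS' by (simp add: opnorm_add_le bounded_op_comp bounded_op_diff)
  also have "\<dots> \<le> opnorm T * opnorm (op_diff T' S') + opnorm (op_diff T S) * opnorm S'"
    using bT bT' bS bS' by (intro add_mono bounded_op_comp bounded_op_diff)
  also have "\<dots> \<le> opnorm T * \<delta>' + \<delta> * opnorm S'"
    using S(2) S'(2) opnorm_nonneg[OF bT] opnorm_nonneg[OF bS']
    by (intro add_mono mult_left_mono mult_right_mono) auto
  also have "\<dots> < (opnorm T + 1) * \<delta>' + \<delta> * (opnorm S' + 1)"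
    using \<delta> \<delta>' by (simp add: algebra_simps)
  also have "\<dots> = \<epsilon>"
  proof -
    have "opnorm T + 1 \<noteq> 0" "opnorm S' + 1 \<noteq> 0"
      using opnorm_nonneg[OF bT] opnorm_nonneg[OF bS'] by linarith+
    moreover have "t * (\<epsilon> / (2 * t)) = \<epsilon> / 2" if "t \<noteq> 0" for t using that by simp
    ultimately show ?thesis unfolding \<delta>_def \<delta>'_def by (metis field_sum_of_halves mult.commute)
  qed
  finally show "\<exists>S\<in>cp_span \<alpha>. opnorm (op_diff (T \<circ> T') S) < \<epsilon>"
    using cp_span_comp[OF S(1) S'(1)] by blast
qed

text \<open>A generator takes the place of \<open>id\<close> because bounded operators here must
  vanish off l2; on l2 it acts as the identity.\<close>

abbreviation op_one :: "('g \<times> 'x) op" where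
  "op_one \<equiv> cp_gen \<alpha> (\<lambda>_. 1) 0"

lemma op_one_apply: "\<xi> \<in> l2 \<Longrightarrow> op_one \<xi> = \<xi>"
  by (auto simp: cp_gen_def)

lemma op_one_comp: "bounded_op T \<Longrightarrow> op_one \<circ> T = T"
  by (simp add: fun_eq_iff op_one_apply bounded_op_in_l2)

lemma op_one_in: "op_one \<in> crossed_product \<alpha>"
  by (intro cp_span_subset cp_span_gen continuous_on_const)

lemma op_one_neq_zero: "op_one \<noteq> op_zero"
proof
  assume eq: "op_one = op_zero"
  have "op_one (basis_vec undefined) undefined = 1"
    unfolding op_one_apply[OF basis_vec_in_l2] by (simp add: basis_vec_def)
  then show False unfolding eq by (simp add: op_zero_def)
qed

section \<open>Matrix entries of the crossed product\<close>

lemma crossed_product_entry_relation: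
  assumes T: "T \<in> crossed_product \<alpha>"
    and span: "\<And>S. S \<in> cp_span \<alpha> \<Longrightarrow> S (basis_vec j) i = z * S (basis_vec j') i'"
  shows "T (basis_vec j) i = z * T (basis_vec j') i'"
proof -
  \<comment> \<open>Entries are norm-continuous, so a linear relation between two of them passes
    from the span to its closure. The choice of \<open>\<delta>\<close> absorbs both errors, the
    second of which is scaled by \<open>z\<close>.\<close>
  have "cmod (T (basis_vec j) i - z * T (basis_vec j') i') \<le> 0 + \<epsilon>" if \<epsilon>: "0 < \<epsilon>" for \<epsilon>
  proof -
    define \<delta> where "\<delta> = \<epsilon> / (1 + cmod z)"
    have z: "0 < 1 + cmod z" by (simp add: add_pos_nonneg)
    then have \<delta>: "0 < \<delta>" using \<epsilon> by (simp add: \<delta>_def)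
    obtain S where S: "S \<in> cp_span \<alpha>" "opnorm (op_diff T S) < \<delta>"
      using crossed_product_approx[OF T \<delta>] .
    define D where "D = op_diff T S"
    have D: "bounded_op D"
      unfolding D_def by (intro bounded_op_diff crossed_product_bounded T cp_span_bounded S)
    have "T (basis_vec j) i - z * T (basis_vec j') i' = D (basis_vec j) i - z * D (basis_vec j') i'"
      using span[OF S(1)] by (simp add: D_def op_diff_def algebra_simps)
    also have "cmod \<dots> \<le> cmod (D (basis_vec j) i) + cmod z * cmod (D (basis_vec j') i')"
      using norm_triangle_ineq4 by (metis norm_mult)
    also have "\<dots> \<le> opnorm D + cmod z * opnorm D"
      using D by (intro add_mono mult_left_mono entry_le_opnorm) auto
    also have "\<dots> = (1 + cmod z) * opnorm D" by (simp add: algebra_simps)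
    also have "\<dots> \<le> (1 + cmod z) * \<delta>"
      using S(2) z by (simp add: D_def)
    also have "\<dots> = \<epsilon>" using z by (simp add: \<delta>_def)
    finally show ?thesis by simp
  qed
  then have "cmod (T (basis_vec j) i - z * T (basis_vec j') i') \<le> 0" by (rule field_le_epsilon)
  then show ?thesis by simp
qed

text \<open>Generators do not move the point coordinate, so the entry vanishes on the span; the
  factor \<open>z = 0\<close> turns the transfer of relations into a transfer of vanishing.\<close>

lemma entry_fibre:
  assumes "T \<in> crossed_product \<alpha>" "y \<noteq> x"
  shows "T (basis_vec (h, x)) (k, y) = 0"
proof -
  have "S (basis_vec (h, x)) (k, y) = 0" if "S \<in> cp_span \<alpha>" for S
    using that
    by (induction rule: cp_span_induct)
       (use assms(2) in \<open>auto simp: op_zero_def op_add_def cp_gen_basis\<close>)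
  then show ?thesis
    using crossed_product_entry_relation[OF assms(1), where z = 0, unfolded mult_zero_left] by blast
qed

text \<open>The crossed product commutes with the right translations
  \<open>\<xi> \<mapsto> (\<lambda>(k, x). \<xi> (k + h, \<alpha> (- h) x))\<close>, which carry the basis vector at
  \<open>(h, x)\<close> to the one at \<open>(0, \<alpha> h x)\<close>.\<close>

lemma entry_translate:
  assumes "T \<in> crossed_product \<alpha>"
  shows "T (basis_vec (h, x)) (k, x) = T (basis_vec (0, \<alpha> h x)) (k - h, \<alpha> h x)"
proof -
  have "S (basis_vec (h, x)) (k, x) = S (basis_vec (0, \<alpha> h x)) (k - h, \<alpha> h x)" if "S \<in> cp_span \<alpha>" for S
    using that
  proof (induction rule: cp_span_induct)
    case (add_gen S f g)
    have "- g + (k - h) = 0 \<longleftrightarrow> - g + k = h"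
      by (metis add_diff_eq eq_iff_diff_eq_0)
    then show ?case
      using add_gen by (simp add: op_add_def cp_gen_basis flip: act_add)
  qed (simp add: op_zero_def)
  then show ?thesis
    using crossed_product_entry_relation[OF assms, where z = 1, unfolded mult_1] by blast
qed

text \<open>The column at \<open>(h, x)\<close> is a translate of the column at
  \<open>(0, \<alpha> h x)\<close>, so vanishing at the neutral element spreads to all columns.
  Contrapositively, a nonzero \<open>c\<close> has a nonzero column there, whence a strictly
  positive diagonal entry of \<open>adj c \<circ> c\<close>.\<close>

lemma crossed_product_eq_zeroI:
  assumes T: "T \<in> crossed_product \<alpha>" and "\<And>x. T (basis_vec (0, x)) = (\<lambda>i. 0)"
  shows "T = op_zero"
proof (rule bounded_op_ext)
  fix p :: "'g \<times> 'x"
  obtain h x where p: "p = (h, x)" by fastforce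
  have "T (basis_vec (h, x)) (k, y) = 0" for k y
    using entry_fibre[OF T] entry_translate[OF T] assms(2) by (cases "y = x") auto
  then show "T (basis_vec p) = op_zero (basis_vec p)"
    by (auto simp: p op_zero_def)
qed (use T crossed_product_bounded in auto)

end

section \<open>Compression into small open sets\<close>


lemma complete_regularity:
  fixes U :: "'x::t2_space set"
  assumes comp: "compact (UNIV :: 'x set)" and U: "open U" "x \<in> U"
  obtains f :: "'x \<Rightarrow> real" where "continuous_on UNIV f" "\<And>y. 0 \<le> f y" "f x = 1" "\<And>y. y \<notin> U \<Longrightarrow> f y = 0"
proof -
  have "compact_space (euclidean :: 'x topology)"
    using comp by (simp add: compact_space_def)
  moreover have "Hausdorff_space (euclidean :: 'x topology)"
    unfolding Hausdorff_space_def by (simp add: disjnt_def) (metis hausdorff)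
  ultimately have "completely_regular_space (euclidean :: 'x topology)"
    by (intro locally_compact_regular_imp_completely_regular_space compact_imp_locally_compact_space) auto
  moreover have "closedin euclidean (- U)" "x \<in> topspace euclidean - (- U)"
    using U by auto
  ultimately obtain f :: "'x \<Rightarrow> real" where f: "continuous_map euclidean (top_of_set {0..1}) f"
      "f x = 0" "f ` (- U) \<subseteq> {1}"
    unfolding completely_regular_space_def by meson
  have rng: "f y \<in> {0..1}" for y
    using continuous_map_image_subset_topspace[OF f(1)] by (simp add: image_subset_iff)
  \<comment> \<open>Complete regularity supplies a function that is 0 at \<open>x\<close> and 1 off
    \<open>U\<close>; subtraction from 1 exchanges these values.\<close>
  show thesis
  proof (rule that[of "\<lambda>y. 1 - f y"])
    show "continuous_on UNIV (\<lambda>y. 1 - f y)"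
      using f(1) by (intro continuous_intros) (simp add: continuous_map_in_subtopology)
  qed (use f rng in \<open>auto simp: image_subset_iff\<close>)
qed

text \<open>By compactness finitely many bump functions suffice. They are grouped by the member of
  \<open>Us\<close> that carries them and normalised by their total. Square roots are taken because
  the squares will appear in \<open>adj r \<circ> r\<close>.\<close>

lemma square_partition_of_unity:
  fixes Us :: "'x::t2_space set set"
  assumes comp: "compact (UNIV :: 'x set)" and Us: "finite Us" "\<And>U. U \<in> Us \<Longrightarrow> open U" "\<Union>Us = UNIV"
  obtains k :: "'x set \<Rightarrow> 'x \<Rightarrow> real" where
    "\<And>U. continuous_on UNIV (k U)" "\<And>U y. k U y \<noteq> 0 \<Longrightarrow> y \<in> U" "\<And>y. (\<Sum>U\<in>Us. (k U y)\<^sup>2) = 1"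
proof -
  have "\<forall>x. \<exists>U f. U \<in> Us \<and> continuous_on UNIV f \<and> (\<forall>y. 0 \<le> f y) \<and> f x = (1::real) \<and> (\<forall>y. y \<notin> U \<longrightarrow> f y = 0)"
  proof
    fix x
    obtain U where U: "U \<in> Us" "x \<in> U" using Us(3) by blast
    show "\<exists>U f. U \<in> Us \<and> continuous_on UNIV f \<and> (\<forall>y. 0 \<le> f y) \<and> f x = (1::real) \<and> (\<forall>y. y \<notin> U \<longrightarrow> f y = 0)"
      by (rule complete_regularity[OF comp Us(2)[OF U(1)] U(2)]) (use U(1) in blast)
  qed
  then obtain V :: "'x \<Rightarrow> 'x set" and f :: "'x \<Rightarrow> 'x \<Rightarrow> real" where
    V: "\<And>x. V x \<in> Us" and cont: "\<And>x. continuous_on UNIV (f x)" and nonneg: "\<And>x y. 0 \<le> f x y"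
    and one: "\<And>x. f x x = 1" and supp: "\<And>x y. y \<notin> V x \<Longrightarrow> f x y = 0"
    by metis
  have op: "open {y. 0 < f x y}" for x
    using cont by (intro open_Collect_less continuous_on_const)
  have "UNIV \<subseteq> (\<Union>x\<in>UNIV. {y. 0 < f x y})"
    using one by (auto intro: exI[where P = "\<lambda>x. 0 < f x _"])
  then obtain D where D: "finite D" "UNIV \<subseteq> (\<Union>x\<in>D. {y. 0 < f x y})"
    using compactE_image[OF comp, of UNIV "\<lambda>x. {y. 0 < f x y}"] op by metis
  define H where "H = (\<lambda>y. \<Sum>x\<in>D. f x y)"
  define h where "h = (\<lambda>U y. \<Sum>x\<in>{x\<in>D. V x = U}. f x y)"
  have H: "0 < H y" for y
  proof -
    obtain x where "x \<in> D" "0 < f x y" using D(2) by auto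
    then show ?thesis unfolding H_def by (intro sum_pos2[of D x]) (auto simp: D nonneg)
  qed
  have h0: "0 \<le> h U y" for U y by (simp add: h_def nonneg sum_nonneg)
  have hH: "(\<Sum>U\<in>Us. h U y) = H y" for y
    unfolding h_def H_def using D(1) Us(1) V by (intro sum.group) auto
  show thesis
  proof (rule that[of "\<lambda>U y. sqrt (h U y / H y)"])
    show "continuous_on UNIV (\<lambda>y. sqrt (h U y / H y))" for U
      using H less_imp_neq[OF H] unfolding h_def H_def
      by (intro continuous_intros cont) (metis less_irrefl)
    show "y \<in> U" if "sqrt (h U y / H y) \<noteq> 0" for U y
    proof (rule ccontr)
      assume "y \<notin> U"
      then have "h U y = 0" unfolding h_def by (intro sum.neutral) (auto simp: supp)
      with that show False by simp
    qed
    show "(\<Sum>U\<in>Us. (sqrt (h U y / H y))\<^sup>2) = 1" for y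
      using H[of y] h0 hH[of y] by (simp add: less_imp_le flip: sum_divide_distrib)
  qed
qed

context compact_group_action
begin

section \<open>Sets displaced by finitely many group elements, and compression into them\<close>

lemma displaced_open_subset:
  assumes free: "topologically_free \<alpha>" and "finite T" "open Ob" "Ob \<noteq> {}"
  obtains P where "open P" "P \<noteq> {}" "P \<subseteq> Ob" "\<And>t. t \<in> T \<Longrightarrow> t \<noteq> 0 \<Longrightarrow> \<alpha> t ` P \<inter> P = {}"
proof -
  have "\<exists>P. open P \<and> P \<noteq> {} \<and> P \<subseteq> Ob \<and> (\<forall>t\<in>T. t \<noteq> 0 \<longrightarrow> \<alpha> t ` P \<inter> P = {})"
    using assms(2)
  proof (induction rule: finite_induct)
    case empty
    then show ?case using assms(3,4) by blast
  next
    case (insert t T)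
    then obtain P where P: "open P" "P \<noteq> {}" "P \<subseteq> Ob" "\<And>t. t \<in> T \<Longrightarrow> t \<noteq> 0 \<Longrightarrow> \<alpha> t ` P \<inter> P = {}"
      by metis
    show ?case
    proof (cases "t = 0")
      case True
      with P show ?thesis by blast
    next
      case False
      \<comment> \<open>A nonempty open set cannot lie in the fixed-point set of \<open>t\<close>,
        whose interior is empty.\<close>
      then have "\<not> P \<subseteq> {x. \<alpha> t x = x}"
        using free P(1,2) interior_maximal[of P "{x. \<alpha> t x = x}"]
        unfolding topologically_free_def by auto
      then obtain x where x: "x \<in> P" "\<alpha> t x \<noteq> x" by blast
      obtain A B where AB: "open A" "open B" "\<alpha> t x \<in> A" "x \<in> B" "A \<inter> B = {}"
        using hausdorff[OF x(2)] by blast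
      have "open (\<alpha> t -` A)" using AB(1) act_continuous by (simp add: continuous_on_open_vimage)
      \<comment> \<open>The shrunken set lies in \<open>B\<close> and its image under
        \<open>t\<close> lies in the disjoint set \<open>A\<close>. Displacement by the earlier
        elements is inherited by subsets.\<close>
      then have "open (P \<inter> B \<inter> \<alpha> t -` A)" "x \<in> P \<inter> B \<inter> \<alpha> t -` A"
        using P(1) AB x(1) by auto
      moreover have "\<alpha> t ` (P \<inter> B \<inter> \<alpha> t -` A) \<inter> (P \<inter> B \<inter> \<alpha> t -` A) = {}"
        using AB(5) by auto
      moreover have "\<alpha> s ` (P \<inter> B \<inter> \<alpha> t -` A) \<inter> (P \<inter> B \<inter> \<alpha> t -` A) = {}" if "s \<in> T" "s \<noteq> 0" for s
        using P(4)[OF that] by auto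
      ultimately show ?thesis using P(3)
        by (intro exI[of _ "P \<inter> B \<inter> \<alpha> t -` A"]) auto
    qed
  qed
  then show thesis using that by metis
qed

text \<open>For \<open>r = \<Sum>U\<in>Us. \<lambda>\<^bsub>s U\<^esub> sqrt (w U)\<close>, whose range lives over \<open>Ob\<close>, compression by \<open>r\<close> kills
  the off-diagonal terms of an element of the span because their group elements displace \<open>Ob\<close>,
  and turns the diagonal part into a multiplication operator.\<close>

definition compresses ::
  "'x set \<Rightarrow> ('g \<times> 'x) op \<Rightarrow> 'x set set \<Rightarrow> ('x set \<Rightarrow> 'x \<Rightarrow> real) \<Rightarrow> ('x set \<Rightarrow> 'g) \<Rightarrow> bool" where
  "compresses Ob r Us w s \<longleftrightarrow> (\<forall>(n::nat) F gs \<xi> h x.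
     (\<forall>i<n. continuous_on UNIV (F i)) \<longrightarrow> (\<forall>i<n. gs i \<noteq> 0 \<longrightarrow> \<alpha> (gs i) ` Ob \<inter> Ob = {}) \<longrightarrow> \<xi> \<in> l2 \<longrightarrow>
     (adj r \<circ> (\<lambda>\<xi> j. \<Sum>i<n. cp_gen \<alpha> (F i) (gs i) \<xi> j) \<circ> r) \<xi> (h, x) =
     (\<Sum>U\<in>Us. of_real (w U (\<alpha> h x)) * (\<Sum>i | i < n \<and> gs i = 0. F i (\<alpha> (s U) (\<alpha> h x)))) * \<xi> (h, x))"

lemma compressesD:
  fixes n :: nat
  assumes "compresses Ob r Us w s" "\<And>i. i < n \<Longrightarrow> continuous_on UNIV (F i)"
    "\<And>i. i < n \<Longrightarrow> gs i \<noteq> 0 \<Longrightarrow> \<alpha> (gs i) ` Ob \<inter> Ob = {}" "\<xi> \<in> l2"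
  shows "(adj r \<circ> (\<lambda>\<xi> j. \<Sum>i<n. cp_gen \<alpha> (F i) (gs i) \<xi> j) \<circ> r) \<xi> (h, x) =
     (\<Sum>U\<in>Us. of_real (w U (\<alpha> h x)) * (\<Sum>i | i < n \<and> gs i = 0. F i (\<alpha> (s U) (\<alpha> h x)))) * \<xi> (h, x)"
  using assms unfolding compresses_def by simp

text \<open>The operator \<open>r\<close> is assembled from functions \<open>sqrt c * k U\<close>,
  where the squares of the \<open>k U\<close> sum to 1, transported into \<open>Ob\<close> by the
  \<open>s U\<close>. A cross term of \<open>U\<close> and \<open>W\<close> in the compression needs
  a point of the translate of \<open>W\<close> that \<open>gs i\<close> sends into the translate of
  \<open>U\<close>. Displacement of \<open>Ob\<close> excludes this for
  \<open>gs i \<noteq> 0\<close>, and disjointness of the translates excludes it for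
  \<open>gs i = 0\<close> unless \<open>U = W\<close>.\<close>

lemma exists_compressing_element:
  assumes sub: "subequiv_closed \<alpha> UNIV Ob" and c: "0 < c"
  obtains r Us and w :: "'x set \<Rightarrow> 'x \<Rightarrow> real" and s where "r \<in> cp_span \<alpha>" "finite Us"
    "\<And>U y. 0 \<le> w U y" "\<And>y. (\<Sum>U\<in>Us. w U y) = c"
    "\<And>U y. U \<in> Us \<Longrightarrow> w U y \<noteq> 0 \<Longrightarrow> \<alpha> (s U) y \<in> Ob"
    "compresses Ob r Us w s"
proof -
  obtain Us s where Us: "finite Us" "\<And>U. U \<in> Us \<Longrightarrow> open U" "\<Union>Us = UNIV"
      and Ob: "\<And>U. U \<in> Us \<Longrightarrow> \<alpha> (s U) ` U \<subseteq> Ob"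
      and disj: "\<And>U W. U \<in> Us \<Longrightarrow> W \<in> Us \<Longrightarrow> U \<noteq> W \<Longrightarrow> \<alpha> (s U) ` U \<inter> \<alpha> (s W) ` W = {}"
    using sub unfolding subequiv_closed_def by (metis top.extremum_uniqueI)
  obtain k where k: "\<And>U. continuous_on UNIV (k U)" "\<And>U y. k U y \<noteq> 0 \<Longrightarrow> y \<in> U"
      "\<And>y. (\<Sum>U\<in>Us. (k U y)\<^sup>2) = (1::real)"
    using square_partition_of_unity[OF compact_UNIV Us] by blast
  define b where "b = (\<lambda>U y. complex_of_real (sqrt c * k U y))"
  \<comment> \<open>In a generator the function stands to the left of the translation, so
    \<open>b U\<close> has to be moved past \<open>s U\<close>; covariance composes it with
    \<open>\<alpha> (- s U)\<close>.\<close>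
  define f where "f = (\<lambda>U y. b U (\<alpha> (- s U) y))"
  define r where "r = (\<lambda>\<xi> j. \<Sum>U\<in>Us. cp_gen \<alpha> (f U) (s U) \<xi> j)"
  define w where "w = (\<lambda>U y. c * (k U y)\<^sup>2)"
  have b_cont: "continuous_on UNIV (b U)" for U
    unfolding b_def by (intro continuous_intros k)
  have f_cont: "continuous_on UNIV (f U)" for U
    unfolding f_def by (intro continuous_act b_cont)
  have b_supp: "b U y \<noteq> 0 \<Longrightarrow> y \<in> U" for U y
    using k(2) by (auto simp: b_def)
  \<comment> \<open>The functions \<open>b U\<close> are real, so the factors contributed by
    \<open>adj r\<close> and by \<open>r\<close> multiply to the weight.\<close>
  have bb: "b U y * b U y = of_real (w U y)" for U y
    using c by (simp add: b_def w_def power2_eq_square flip: of_real_mult)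
  have r: "r \<in> cp_span \<alpha>"
    unfolding r_def using Us(1) f_cont by (intro cp_span_sum)
  have adj_r: "adj r = (\<lambda>\<xi> j. \<Sum>U\<in>Us. cp_gen \<alpha> (b U) (- s U) \<xi> j)"
    unfolding r_def by (subst adj_sum_cp_gen) (auto simp: Us f_cont, simp add: f_def b_def)
  show thesis
  proof (rule that[OF r Us(1), of w s])
    show "0 \<le> w U y" for U y using c by (simp add: w_def)
    show "(\<Sum>U\<in>Us. w U y) = c" for y by (simp add: w_def k flip: sum_distrib_left)
    show "\<alpha> (s U) y \<in> Ob" if "U \<in> Us" "w U y \<noteq> 0" for U y
      using Ob[OF that(1)] k(2)[of U y] that(2) by (auto simp: w_def)
    show "compresses Ob r Us w s"
      unfolding compresses_def
    proof (intro allI impI)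
      fix n :: nat and F :: "nat \<Rightarrow> 'x \<Rightarrow> complex" and gs h x and \<xi> :: "'g \<times> 'x \<Rightarrow> complex"
      assume F: "\<forall>i<n. continuous_on UNIV (F i)"
        and gs: "\<forall>i<n. gs i \<noteq> 0 \<longrightarrow> \<alpha> (gs i) ` Ob \<inter> Ob = {}"
        and \<xi>: "\<xi> \<in> l2"
      define S where "S = (\<lambda>\<xi> j. \<Sum>i<n. cp_gen \<alpha> (F i) (gs i) \<xi> j)"
      have S: "S \<in> cp_span \<alpha>" unfolding S_def using F by (intro cp_span_sum) auto
      have r\<xi>: "r \<xi> \<in> l2" and Sr\<xi>: "S (r \<xi>) \<in> l2"
        by (intro bounded_op_in_l2 cp_span_bounded r S)+
      define y where "y = \<alpha> h x"
      have r_app: "r \<xi> (h', x') = (\<Sum>W\<in>Us. b W (\<alpha> (- s W) (\<alpha> h' x')) * \<xi> (- s W + h', x'))" for h' x'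
        by (simp add: r_def f_def cp_gen_apply[OF \<xi>])
      have summand: "F i (\<alpha> (s U) y) * r \<xi> (- gs i + (s U + h), x) =
          (if gs i = 0 then F i (\<alpha> (s U) y) * (b U y * \<xi> (h, x)) else 0)"
        if U: "U \<in> Us" "y \<in> U" and i: "i < n" for U i
      proof (cases "gs i = 0")
        case True
        have "b W (\<alpha> (- s W) (\<alpha> (s U) y)) = 0" if W: "W \<in> Us" "W \<noteq> U" for W
        proof (rule ccontr)
          assume "b W (\<alpha> (- s W) (\<alpha> (s U) y)) \<noteq> 0"
          then have "\<alpha> (s W) (\<alpha> (- s W) (\<alpha> (s U) y)) \<in> \<alpha> (s W) ` W"
            using b_supp by blast
          then show False using disj[OF W(1) U(1) W(2)] U(2) by auto
        qed
        then have "r \<xi> (s U + h, x) = (\<Sum>W\<in>{U}. b W (\<alpha> (- s W) (\<alpha> (s U) y)) * \<xi> (- s W + (s U + h), x))"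
          unfolding r_app act_add y_def[symmetric] using U Us(1)
          by (intro sum.mono_neutral_right) auto
        then show ?thesis using True by (simp flip: add.assoc)
      next
        case False
        have "b W (\<alpha> (- s W) (\<alpha> (- gs i) (\<alpha> (s U) y))) = 0" if W: "W \<in> Us" for W
        proof (rule ccontr)
          let ?z = "\<alpha> (- gs i) (\<alpha> (s U) y)"
          assume "b W (\<alpha> (- s W) ?z) \<noteq> 0"
          then have "\<alpha> (s W) (\<alpha> (- s W) ?z) \<in> Ob"
            using b_supp Ob[OF W] by blast
          then have "?z \<in> Ob" by simp
          then have "\<alpha> (gs i) ?z \<in> \<alpha> (gs i) ` Ob" by (rule imageI)
          moreover have "\<alpha> (gs i) ?z \<in> Ob" using Ob[OF U(1)] U(2) by auto
          ultimately show False using gs i False by blast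
        qed
        then have "r \<xi> (- gs i + (s U + h), x) = 0"
          unfolding r_app act_add y_def[symmetric] by simp
        then show ?thesis using False by simp
      qed
      have "(adj r \<circ> S \<circ> r) \<xi> (h, x) =
          (\<Sum>U\<in>Us. b U y * (\<Sum>i<n. F i (\<alpha> (s U) y) * r \<xi> (- gs i + (s U + h), x)))"
        unfolding adj_r o_apply cp_gen_apply[OF Sr\<xi>] y_def[symmetric]
        by (simp add: S_def cp_gen_apply[OF r\<xi>] act_add y_def)
      also have "\<dots> = (\<Sum>U\<in>Us. of_real (w U y) * (\<Sum>i | i < n \<and> gs i = 0. F i (\<alpha> (s U) y)) * \<xi> (h, x))"
      proof (rule sum.cong[OF refl])
        fix U assume U: "U \<in> Us"
        \<comment> \<open>The collapse of the inner sum needs \<open>y \<in> U\<close>, which is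
          known wherever \<open>b U y\<close> is nonzero; elsewhere both sides vanish.\<close>
        show "b U y * (\<Sum>i<n. F i (\<alpha> (s U) y) * r \<xi> (- gs i + (s U + h), x)) =
            of_real (w U y) * (\<Sum>i | i < n \<and> gs i = 0. F i (\<alpha> (s U) y)) * \<xi> (h, x)"
        proof (cases "b U y = 0")
          case True
          then show ?thesis using bb[of U y] by simp
        next
          case False
          then have "y \<in> U" by (rule b_supp)
          then have "(\<Sum>i<n. F i (\<alpha> (s U) y) * r \<xi> (- gs i + (s U + h), x)) =
              (\<Sum>i<n. if gs i = 0 then F i (\<alpha> (s U) y) * (b U y * \<xi> (h, x)) else 0)"
            using summand[OF U] by (intro sum.cong) auto
          also have "\<dots> = (\<Sum>i | i < n \<and> gs i = 0. F i (\<alpha> (s U) y) * (b U y * \<xi> (h, x)))"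
            by (simp add: sum.inter_filter[symmetric] lessThan_def)
          finally show ?thesis
            by (simp add: bb[symmetric] sum_distrib_left sum_distrib_right mult_ac)
        qed
      qed
      finally show "(adj r \<circ> (\<lambda>\<xi> j. \<Sum>i<n. cp_gen \<alpha> (F i) (gs i) \<xi> j) \<circ> r) \<xi> (h, x) =
         (\<Sum>U\<in>Us. of_real (w U (\<alpha> h x)) * (\<Sum>i | i < n \<and> gs i = 0. F i (\<alpha> (s U) (\<alpha> h x)))) * \<xi> (h, x)"
        by (simp add: S_def y_def sum_distrib_right)
    qed
  qed
qed

section \<open>Compressing a nonzero positive element to nearly the unit\<close>

lemma exists_inverting_compression:
  assumes free: "topologically_free \<alpha>"
    and sub: "\<And>Ob. open Ob \<Longrightarrow> Ob \<noteq> {} \<Longrightarrow> subequiv_closed \<alpha> UNIV Ob"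
    and c: "c \<in> crossed_product \<alpha>" "c \<noteq> op_zero" and \<epsilon>: "0 < \<epsilon>"
  obtains r where "r \<in> crossed_product \<alpha>"
    "opnorm (op_diff (adj r \<circ> (adj c \<circ> c) \<circ> r) op_one) < \<epsilon>"
proof -
  define a where "a = adj c \<circ> c"
  have bc: "bounded_op c" using c(1) by (rule crossed_product_bounded)
  have a: "a \<in> crossed_product \<alpha>"
    unfolding a_def by (intro crossed_product_comp crossed_product_adj c)
  then have ba: "bounded_op a" by (rule crossed_product_bounded)
  obtain x0 where x0: "c (basis_vec (0, x0)) \<noteq> (\<lambda>i. 0)"
    using crossed_product_eq_zeroI[OF c(1)] c(2) by blast
  define e0 :: "'g \<times> 'x \<Rightarrow> complex" where "e0 = basis_vec (0, x0)"
  define m where "m = (l2norm (c e0))\<^sup>2"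
  have ce0: "c e0 \<in> l2" using bc by (rule bounded_op_in_l2)
  have m: "0 < m"
    using x0 l2norm_eq_0_iff[OF ce0] by (simp add: m_def e0_def)
  have "l2inner (a e0) e0 = l2inner (c e0) (c e0)"
    using adj_inner[OF bc ce0, of e0] by (simp add: a_def e0_def)
  then have "cnj (a e0 (0, x0)) = of_real m"
    unfolding l2inner_self[OF ce0] by (simp add: e0_def m_def l2inner_basis_right)
  then have a_diag: "a e0 (0, x0) = of_real m"
    by (metis complex_cnj_cnj complex_cnj_complex_of_real)
  \<comment> \<open>Scaling by \<open>1 / m\<close> turns \<open>\<delta>\<close> into
    \<open>\<epsilon> / 4\<close>. Two such errors occur: one from the approximation by
    \<open>S\<close>, one from the deviation of its diagonal from \<open>m\<close> on
    \<open>P\<close>.\<close>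
  define \<delta> where "\<delta> = \<epsilon> * m / 4"
  have \<delta>: "0 < \<delta>" using \<epsilon> m by (simp add: \<delta>_def)
  obtain S where S: "S \<in> cp_span \<alpha>" "opnorm (op_diff a S) < \<delta>"
    using crossed_product_approx[OF a \<delta>] .
  have bS: "bounded_op S" using S(1) by (rule cp_span_bounded)
  obtain n :: nat and F gs where F: "\<And>i. i < n \<Longrightarrow> continuous_on UNIV (F i)"
      and S_eq: "S = (\<lambda>\<xi> j. \<Sum>i<n. cp_gen \<alpha> (F i) (gs i) \<xi> j)"
    using S(1) unfolding cp_span_def by blast
  \<comment> \<open>\<open>E\<close> is the coefficient of \<open>S\<close> at the neutral element,
    that is, its conditional expectation onto the continuous functions; at \<open>x0\<close> it
    equals the diagonal entry at \<open>(0, x0)\<close>.\<close>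
  define E where "E = (\<lambda>y. \<Sum>i | i < n \<and> gs i = 0. F i y)"
  have E_cont: "continuous_on UNIV E"
    unfolding E_def using F by (intro continuous_on_sum) auto
  have "S e0 (0, x0) = (\<Sum>i<n. if gs i = 0 then F i x0 else 0)"
    by (simp add: S_eq e0_def cp_gen_basis cong: if_cong)
  also have "\<dots> = E x0"
    by (simp add: E_def sum.inter_filter[symmetric] lessThan_def)
  finally have "of_real m - E x0 = op_diff a S e0 (0, x0)"
    by (simp add: op_diff_def a_diag)
  then have E_x0: "cmod (E x0 - of_real m) < \<delta>"
    using entry_le_opnorm[OF bounded_op_diff[OF ba bS], of "(0, x0)" "(0, x0)"] S(2)
    unfolding e0_def by (metis norm_minus_commute le_less_trans)
  have "open {y. cmod (E y - of_real m) < \<delta>}"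
    by (intro open_Collect_less continuous_intros E_cont)
  with E_x0 obtain P where P: "open P" "P \<noteq> {}" "P \<subseteq> {y. cmod (E y - of_real m) < \<delta>}"
      "\<And>t. t \<in> gs ` {..<n} \<Longrightarrow> t \<noteq> 0 \<Longrightarrow> \<alpha> t ` P \<inter> P = {}"
    using displaced_open_subset[OF free, of "gs ` {..<n}" "{y. cmod (E y - of_real m) < \<delta>}"] by blast
  \<comment> \<open>With total weight \<open>1 / m\<close>, compressing \<open>m\<close> times the
    unit gives the unit.\<close>
  have m': "0 < 1 / m" using m by simp
  obtain r Us and w :: "'x set \<Rightarrow> 'x \<Rightarrow> real" and s where r: "r \<in> cp_span \<alpha>" and Us: "finite Us"
    and w: "\<And>U y. 0 \<le> w U y" "\<And>y. (\<Sum>U\<in>Us. w U y) = 1 / m"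
      "\<And>U y. U \<in> Us \<Longrightarrow> w U y \<noteq> 0 \<Longrightarrow> \<alpha> (s U) y \<in> P"
    and compress: "compresses P r Us w s"
    using exists_compressing_element[OF sub[OF P(1,2)] m'] by blast
  have br: "bounded_op r" using r by (rule cp_span_bounded)
  have w_sum: "(\<Sum>U\<in>Us. complex_of_real (w U y)) = of_real (1 / m)" for y
    using w(2)[of y] by (metis of_real_sum)
  \<comment> \<open>Compression of the unit, taken as a sum with the single summand 1 at the neutral
    element, leaves only the total weight.\<close>
  have rr: "(adj r \<circ> r) \<xi> = (\<lambda>i. of_real (1 / m) * \<xi> i)" if \<xi>: "\<xi> \<in> l2" for \<xi>
  proof
    fix p :: "'g \<times> 'x"
    obtain h x where p: "p = (h, x)" by fastforce
    have "(adj r \<circ> (\<lambda>\<xi> j. \<Sum>i<(1::nat). cp_gen \<alpha> (\<lambda>_. 1) 0 \<xi> j) \<circ> r) \<xi> (h, x) = of_real (1 / m) * \<xi> (h, x)"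
      using compressesD[OF compress, of 1 "\<lambda>_ _. 1" "\<lambda>_. 0" \<xi> h x] by (simp add: \<xi> w_sum)
    then show "(adj r \<circ> r) \<xi> p = of_real (1 / m) * \<xi> p"
      by (simp add: p op_one_apply[OF bounded_op_in_l2[OF br]])
  qed
  have r_norm: "(opnorm r)\<^sup>2 \<le> 1 / m"
  proof -
    have "opnorm r \<le> sqrt (1 / m)"
    proof (rule opnorm_le)
      fix \<xi> :: "'g \<times> 'x \<Rightarrow> complex" assume \<xi>: "\<xi> \<in> l2"
      have "of_real ((l2norm (r \<xi>))\<^sup>2) = l2inner (r \<xi>) (r \<xi>)"
        using l2inner_self[OF bounded_op_in_l2[OF br]] by simp
      also have "\<dots> = l2inner ((adj r \<circ> r) \<xi>) \<xi>"
        using adj_inner[OF br bounded_op_in_l2[OF br] \<xi>] by simp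
      also have "\<dots> = of_real (1 / m * (l2norm \<xi>)\<^sup>2)"
        using l2inner_lincomb_left[OF \<xi> zero_in_l2 \<xi>, of "of_real (1 / m)"]
        unfolding rr[OF \<xi>] by (simp add: l2inner_self[OF \<xi>])
      finally have "(l2norm (r \<xi>))\<^sup>2 = 1 / m * (l2norm \<xi>)\<^sup>2"
        by (simp only: of_real_eq_iff)
      then have "l2norm (r \<xi>) = sqrt (1 / m * (l2norm \<xi>)\<^sup>2)"
        using l2norm_nonneg[of "r \<xi>"] by (metis real_sqrt_unique)
      then show "l2norm (r \<xi>) \<le> sqrt (1 / m) * l2norm \<xi>"
        by (simp add: real_sqrt_mult l2norm_nonneg real_sqrt_divide)
    qed (use m in simp)
    then have "(opnorm r)\<^sup>2 \<le> (sqrt (1 / m))\<^sup>2"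
      using opnorm_nonneg[OF br] by (rule power_mono)
    then show ?thesis using m by simp
  qed
  define D where "D = op_diff a S"
  have D: "bounded_op D" unfolding D_def by (intro bounded_op_diff ba bS)
  \<comment> \<open>\<open>b\<close> is what remains of the compressed \<open>S\<close> after
    subtracting the unit. Writing 1 as \<open>m\<close> times the total weight makes it a weighted
    sum of deviations of \<open>E\<close> from \<open>m\<close> at points of
    \<open>P\<close>.\<close>
  define b where "b = (\<lambda>y. (\<Sum>U\<in>Us. of_real (w U y) * E (\<alpha> (s U) y)) - 1)"
  have b_bound: "cmod (b y) \<le> \<epsilon> / 4" for y
  proof -
    have "b y = (\<Sum>U\<in>Us. of_real (w U y) * E (\<alpha> (s U) y)) - of_real m * (\<Sum>U\<in>Us. of_real (w U y))"
      using m by (simp add: b_def w_sum)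
    also have "\<dots> = (\<Sum>U\<in>Us. of_real (w U y) * (E (\<alpha> (s U) y) - of_real m))"
      by (simp add: sum_subtractf sum_distrib_left algebra_simps)
    also have "cmod \<dots> \<le> (\<Sum>U\<in>Us. w U y * \<delta>)"
    proof (rule sum_norm_le)
      fix U assume U: "U \<in> Us"
      show "cmod (of_real (w U y) * (E (\<alpha> (s U) y) - of_real m)) \<le> w U y * \<delta>"
      proof (cases "w U y = 0")
        case False
        then have "cmod (E (\<alpha> (s U) y) - of_real m) < \<delta>" using w(3)[OF U] P(3) by blast
        then show ?thesis by (simp add: norm_mult w(1) mult_left_mono)
      qed simp
    qed
    also have "\<dots> = \<epsilon> / 4" unfolding sum_distrib_right[symmetric] w(2) using m by (simp add: \<delta>_def)
    finally show ?thesis .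
  qed
  \<comment> \<open>Since \<open>a\<close> is \<open>S\<close> plus \<open>D\<close>, and
    \<open>S\<close> compresses to multiplication by \<open>1 + b\<close>, only two small terms
    remain.\<close>
  have "op_diff (adj r \<circ> a \<circ> r) op_one = op_add (adj r \<circ> D \<circ> r) (cp_gen \<alpha> b 0)"
  proof (intro ext)
    fix \<xi> :: "'g \<times> 'x \<Rightarrow> complex" and p :: "'g \<times> 'x"
    obtain h x where p: "p = (h, x)" by fastforce
    show "op_diff (adj r \<circ> a \<circ> r) op_one \<xi> p = op_add (adj r \<circ> D \<circ> r) (cp_gen \<alpha> b 0) \<xi> p"
    proof (cases "\<xi> \<in> l2")
      case True
      have Srr: "(adj r \<circ> S \<circ> r) \<xi> (h, x) =
          (\<Sum>U\<in>Us. of_real (w U (\<alpha> h x)) * E (\<alpha> (s U) (\<alpha> h x))) * \<xi> (h, x)"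
        unfolding S_eq E_def using F P(4) True by (intro compressesD[OF compress]) auto
      have "(adj r \<circ> D) (r \<xi>) = (\<lambda>i. (adj r \<circ> a) (r \<xi>) i - (adj r \<circ> S) (r \<xi>) i)"
        unfolding D_def comp_op_diff[OF adj_bounded[OF br] ba bS] by (simp add: op_diff_def)
      then show ?thesis
        using Srr True by (simp add: p op_diff_def op_add_def cp_gen_apply b_def algebra_simps)
    next
      case False
      have "(adj r \<circ> T \<circ> r) \<xi> = (\<lambda>i. 0)" if "bounded_op T" for T
        using False by (intro bounded_op_off bounded_op_comp adj_bounded br that)
      then show ?thesis
        unfolding op_diff_def op_add_def cp_gen_off[OF False] using ba D by (simp del: o_apply)
    qed
  qed
  then have "opnorm (op_diff (adj r \<circ> a \<circ> r) op_one) \<le> opnorm (adj r \<circ> D \<circ> r) + opnorm (cp_gen \<alpha> b 0)"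
    using opnorm_add_le[of "adj r \<circ> D \<circ> r" "cp_gen \<alpha> b 0"] cp_gen_bound(1)[OF b_bound]
    by (simp add: bounded_op_comp adj_bounded br D)
  also have "\<dots> \<le> (opnorm r)\<^sup>2 * opnorm D + \<epsilon> / 4"
  proof (rule add_mono)
    have "opnorm (adj r \<circ> D \<circ> r) \<le> opnorm (adj r \<circ> D) * opnorm r"
      by (intro bounded_op_comp adj_bounded br D)
    also have "\<dots> \<le> opnorm (adj r) * opnorm D * opnorm r"
      by (intro mult_right_mono bounded_op_comp adj_bounded br D opnorm_nonneg)
    also have "\<dots> \<le> opnorm r * opnorm D * opnorm r"
      by (intro mult_right_mono opnorm_adj_le br D opnorm_nonneg)
    finally show "opnorm (adj r \<circ> D \<circ> r) \<le> (opnorm r)\<^sup>2 * opnorm D"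
      by (simp add: power2_eq_square mult_ac)
  qed (rule cp_gen_bound(2)[OF b_bound])
  also have "\<dots> \<le> 1 / m * \<delta> + \<epsilon> / 4"
    using r_norm S(2) m' opnorm_nonneg[OF D] by (intro add_mono mult_mono) (auto simp: D_def)
  also have "\<dots> < \<epsilon>" using m \<epsilon> by (simp add: \<delta>_def)
  finally show thesis
    using that cp_span_subset[OF r] unfolding a_def by blast
qed

section \<open>Absence of characters\<close>

lemma no_character:
  assumes inf: "infinite (UNIV :: 'g set)" and free: "topologically_free \<alpha>"
    and sub: "\<And>Ob. open Ob \<Longrightarrow> Ob \<noteq> {} \<Longrightarrow> subequiv_closed \<alpha> UNIV Ob"
  shows "\<not> character (crossed_product \<alpha>) \<phi>"
proof
  assume \<phi>: "character (crossed_product \<alpha>) \<phi>"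
  have mult: "\<phi> (S \<circ> T) = \<phi> S * \<phi> T" if "S \<in> crossed_product \<alpha>" "T \<in> crossed_product \<alpha>" for S T
    using \<phi> that unfolding character_def by blast
  obtain R where R: "R \<in> crossed_product \<alpha>" "\<phi> R \<noteq> 0"
    using \<phi> unfolding character_def by blast
  have one: "\<phi> op_one \<noteq> 0"
    using mult[OF op_one_in R(1)] R(2) op_one_comp[OF crossed_product_bounded[OF R(1)]] by auto
  have zero_in: "op_zero \<in> crossed_product \<alpha>" using cp_span_zero by (rule cp_span_subset)
  have zero: "\<phi> op_zero = 0"
  proof -
    have eq: "op_add op_zero (op_smul 1 op_zero) = op_zero"
      by (simp add: op_add_def op_smul_def op_zero_def)
    have "\<phi> (op_add op_zero (op_smul 1 op_zero)) = \<phi> op_zero + 1 * \<phi> op_zero"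
      using \<phi> zero_in unfolding character_def by blast
    then show ?thesis unfolding eq by simp
  qed
  obtain t :: 'g where t: "t \<noteq> 0"
    using inf by (metis UNIV_eq_I finite.emptyI finite.insertI insertI1)
  define u where "u = (\<lambda>g. cp_gen \<alpha> (\<lambda>_. 1) g)"
  have u_in: "u g \<in> crossed_product \<alpha>" for g
    unfolding u_def by (intro cp_span_subset cp_span_gen continuous_on_const)
  have "u t \<circ> u (- t) = op_one"
    unfolding u_def by (subst cp_gen_comp) simp_all
  \<comment> \<open>A character that is nonzero at the unit is nonzero at every invertible
    element.\<close>
  then have ut: "\<phi> (u t) \<noteq> 0"
    using mult[OF u_in u_in, of t "- t"] one by auto
  obtain P where P: "open P" "P \<noteq> {}" "\<alpha> t ` P \<inter> P = {}"
    by (rule displaced_open_subset[OF free, of "{t}" UNIV]) (auto intro!: that simp: t)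
  \<comment> \<open>Here the total weight is 1, so the compression of the unit is the unit
    itself.\<close>
  obtain r Us and w :: "'x set \<Rightarrow> 'x \<Rightarrow> real" and s where r: "r \<in> cp_span \<alpha>"
    and w: "\<And>y. (\<Sum>U\<in>Us. w U y) = 1"
    and compress: "compresses P r Us w s"
    by (rule exists_compressing_element[OF sub[OF P(1,2)] zero_less_one]) (rule that)
  have br: "bounded_op r" using r by (rule cp_span_bounded)
  have r_in: "r \<in> crossed_product \<alpha>" "adj r \<in> crossed_product \<alpha>"
    using r by (auto intro: cp_span_subset cp_span_adj)
  have w_sum: "(\<Sum>U\<in>Us. complex_of_real (w U y)) = 1" for y
    using w[of y] by (metis of_real_1 of_real_sum)
  have compress_u: "(adj r \<circ> u g \<circ> r) \<xi> = (if g = 0 then \<xi> else (\<lambda>i. 0))"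
    if \<xi>: "\<xi> \<in> l2" and g: "g = 0 \<or> g = t" for g \<xi>
  proof
    fix p :: "'g \<times> 'x"
    obtain h x where p: "p = (h, x)" by fastforce
    have "(adj r \<circ> (\<lambda>\<xi> j. \<Sum>i<(1::nat). cp_gen \<alpha> (\<lambda>_. 1) g \<xi> j) \<circ> r) \<xi> (h, x) = (if g = 0 then \<xi> else (\<lambda>i. 0)) (h, x)"
      using compressesD[OF compress, of 1 "\<lambda>_ _. 1" "\<lambda>_. g" \<xi> h x] g P(3) t by (auto simp: \<xi> w_sum)
    then show "(adj r \<circ> u g \<circ> r) \<xi> p = (if g = 0 then \<xi> else (\<lambda>i. 0)) p"
      by (simp add: p u_def)
  qed
  have bu: "bounded_op (adj r \<circ> u g \<circ> r)" for g
    by (intro bounded_op_comp adj_bounded br crossed_product_bounded[OF u_in])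
  have "adj r \<circ> u t \<circ> r = op_zero"
    by (rule bounded_op_ext[OF bu bounded_op_zero]) (simp add: compress_u t op_zero_def del: o_apply)
  moreover have "adj r \<circ> u 0 \<circ> r = op_one"
    by (rule bounded_op_ext[OF bu crossed_product_bounded[OF op_one_in]])
       (simp add: compress_u op_one_apply del: o_apply)
  \<comment> \<open>The second product is \<open>\<phi> op_one\<close>, so
    \<open>\<phi> (adj r)\<close> and \<open>\<phi> r\<close> are nonzero; together with
    \<open>\<phi> (u t) \<noteq> 0\<close> this contradicts the vanishing of the first.\<close>
  ultimately have "\<phi> (adj r) * \<phi> (u t) * \<phi> r = 0" "\<phi> (adj r) * \<phi> (u 0) * \<phi> r \<noteq> 0"
    using mult r_in u_in crossed_product_comp zero one by metis+
  with ut show False by auto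
qed

section \<open>Closed ideals of the crossed product\<close>

lemma closed_ideal_eq:
  assumes free: "topologically_free \<alpha>"
    and sub: "\<And>Ob. open Ob \<Longrightarrow> Ob \<noteq> {} \<Longrightarrow> subequiv_closed \<alpha> UNIV Ob"
    and J: "closed_ideal (crossed_product \<alpha>) J" and c: "c \<in> J" "c \<noteq> op_zero"
  shows "J = crossed_product \<alpha>"
proof
  show JA: "J \<subseteq> crossed_product \<alpha>" using J by (simp add: closed_ideal_def)
  have ideal: "S \<circ> T \<in> J" "T \<circ> S \<in> J" if "S \<in> J" "T \<in> crossed_product \<alpha>" for S T
    using J that unfolding closed_ideal_def by blast+
  have c': "c \<in> crossed_product \<alpha>" using c(1) JA by blast
  have "\<exists>S\<in>J. opnorm (op_diff op_one S) < \<epsilon>" if \<epsilon>: "0 < \<epsilon>" for \<epsilon>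
  proof -
    obtain r where r: "r \<in> crossed_product \<alpha>"
      "opnorm (op_diff (adj r \<circ> (adj c \<circ> c) \<circ> r) op_one) < \<epsilon>"
      using exists_inverting_compression[OF free sub c' c(2) \<epsilon>] by blast
    \<comment> \<open>The compression contains \<open>c\<close> as a factor, so it stays in
      \<open>J\<close> while approximating the unit; closedness then puts the unit into
      \<open>J\<close>.\<close>
    have "adj r \<circ> (adj c \<circ> c) \<circ> r \<in> J"
      by (intro ideal crossed_product_adj r(1) c' c(1))
    then show ?thesis using r(2) by (metis opnorm_diff_commute)
  qed
  then have "op_one \<in> J" using J op_one_in unfolding closed_ideal_def by blast
  then show "crossed_product \<alpha> \<subseteq> J"
    using ideal(1) op_one_comp[OF crossed_product_bounded] by (metis subsetI)
qed

text \<open>This serves the case \<open>a = 0\<close> of the Cuntz comparison, where the generated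
  ideal is zero and so \<open>b = 0\<close>. Closedness holds because the operator norm bounds every
  matrix entry.\<close>

lemma closed_ideal_zero: "closed_ideal (crossed_product \<alpha>) {op_zero}"
  unfolding closed_ideal_def
proof (intro conjI ballI allI impI)
  fix T assume T: "T \<in> crossed_product \<alpha>" and *: "\<forall>\<epsilon>>0. \<exists>S\<in>{op_zero}. opnorm (op_diff T S) < \<epsilon>"
  have "op_diff T op_zero = T" by (simp add: op_diff_def op_zero_def)
  with * have "opnorm T \<le> 0 + \<epsilon>" if "0 < \<epsilon>" for \<epsilon> using that by (auto intro: less_imp_le)
  then have le: "opnorm T \<le> 0" by (rule field_le_epsilon)
  have "T (basis_vec j) i = 0" for i j
    using order.trans[OF entry_le_opnorm[OF crossed_product_bounded[OF T]] le] by simp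
  then have "T = op_zero"
    by (intro bounded_op_ext[OF crossed_product_bounded[OF T] bounded_op_zero]) (auto simp: op_zero_def)
  then show "T \<in> {op_zero}" by simp
qed (auto simp: cp_span_zero cp_span_subset comp_op_zero crossed_product_bounded,
    auto simp: op_add_def op_smul_def op_zero_def)

end

section \<open>Pure infiniteness and simplicity\<close>

theorem theorem1p1:
  fixes \<alpha> :: "'g::{group_add,countable} \<Rightarrow> 'x::t2_space \<Rightarrow> 'x"
  assumes "infinite (UNIV :: 'g set)"
    and "compact (UNIV :: 'x set)"
    and "group_action \<alpha>"
    and "minimal_action \<alpha>"
    and "topologically_free \<alpha>"
    and "\<not> (\<exists>\<mu>. inv_reg_prob \<alpha> \<mu>)"
    and "dyn_comparison \<alpha>"
  shows "purely_infinite (crossed_product \<alpha>) \<and> simple_alg (crossed_product \<alpha>)"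
proof -
  interpret compact_group_action \<alpha>
    using assms(2,3) by unfold_locales
  let ?A = "crossed_product \<alpha>"
  \<comment> \<open>Without invariant measures the measure condition in comparison is vacuous; it is
    applied with the whole space as the open set and as its closed subset.\<close>
  have sub: "subequiv_closed \<alpha> UNIV Ob" if "open Ob" "Ob \<noteq> {}" for Ob
    using assms(6,7) that unfolding dyn_comparison_def subequiv_open_def by blast
  have cuntz: "cuntz_below ?A b a" if a: "positive_el ?A a" and b: "positive_el ?A b" "b \<in> ideal_gen ?A a" for a b
  proof -
    obtain c where c: "c \<in> ?A" "a = adj c \<circ> c" using a unfolding positive_el_def by blast
    obtain d where d: "d \<in> ?A" "b = adj d \<circ> d" using b(1) unfolding positive_el_def by blast
    have bd: "bounded_op d" using d(1) by (rule crossed_product_bounded)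
    show ?thesis
    proof (cases "c = op_zero")
      case True
      then have a0: "a = op_zero" by (simp add: c(2) adj_op_zero comp_op_zero)
      then have "b = op_zero"
        using b(2) closed_ideal_zero unfolding ideal_gen_def by blast
      moreover have "op_diff (adj op_zero \<circ> op_zero \<circ> op_zero) op_zero = (op_zero :: ('g \<times> 'x) op)"
        by (simp add: adj_op_zero comp_op_zero op_diff_def) (simp add: op_zero_def)
      ultimately show ?thesis
        unfolding cuntz_below_def a0
        by (intro exI[of _ "\<lambda>_. op_zero"]) (simp add: cp_span_zero cp_span_subset)
    next
      case False
      have "\<forall>n. \<exists>r. r \<in> ?A \<and> opnorm (op_diff (adj r \<circ> a \<circ> r) op_one) < inverse (real (Suc n))"
        using exists_inverting_compression[OF assms(5) sub c(1) False] c(2) by (metis inverse_Suc)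
      then obtain r where r: "\<And>n. r n \<in> ?A"
          "\<And>n. opnorm (op_diff (adj (r n) \<circ> a \<circ> r n) op_one) < inverse (real (Suc n))"
        by metis
      have ba: "bounded_op a"
        unfolding c(2) by (intro bounded_op_comp adj_bounded crossed_product_bounded c(1))
      have br: "bounded_op (r n)" for n using r(1) by (rule crossed_product_bounded)
      define D where "D = (\<lambda>n. op_diff (adj (r n) \<circ> a \<circ> r n) op_one)"
      have D: "bounded_op (D n)" for n
        unfolding D_def by (intro bounded_op_diff bounded_op_comp adj_bounded ba br
            crossed_product_bounded[OF op_one_in])
      \<comment> \<open>Because \<open>b\<close> is \<open>adj d \<circ> op_one \<circ> d\<close>,
        compressing by \<open>r n \<circ> d\<close> sandwiches the error \<open>D n\<close> between
        \<open>adj d\<close> and \<open>d\<close>; these elements witness the Cuntz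
        comparison.\<close>
      have "op_diff (adj (r n \<circ> d) \<circ> a \<circ> (r n \<circ> d)) b = adj d \<circ> D n \<circ> d" for n
      proof -
        have "adj d \<circ> D n = op_diff (adj d \<circ> (adj (r n) \<circ> a \<circ> r n)) (adj d \<circ> op_one)"
          unfolding D_def
          by (intro comp_op_diff bounded_op_comp adj_bounded ba br bd crossed_product_bounded[OF op_one_in])
        then have "adj d \<circ> D n \<circ> d = op_diff (adj d \<circ> (adj (r n) \<circ> a \<circ> r n)) (adj d \<circ> op_one) \<circ> d"
          by simp
        then show ?thesis
          unfolding adj_comp[OF br bd] d(2)
          by (simp add: op_diff_def fun_eq_iff op_one_apply bounded_op_in_l2[OF bd])
      qed
      then have upper: "opnorm (op_diff (adj (r n \<circ> d) \<circ> a \<circ> (r n \<circ> d)) b) \<le>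
          opnorm (adj d) * opnorm d * inverse (real (Suc n))" for n
      proof -
        have "opnorm (adj d \<circ> D n \<circ> d) \<le> opnorm (adj d \<circ> D n) * opnorm d"
          by (intro bounded_op_comp adj_bounded bd D)
        also have "\<dots> \<le> opnorm (adj d) * opnorm (D n) * opnorm d"
          by (intro mult_right_mono bounded_op_comp adj_bounded bd D opnorm_nonneg)
        also have "\<dots> \<le> opnorm (adj d) * inverse (real (Suc n)) * opnorm d"
          using r(2)[of n] unfolding D_def
          by (intro mult_right_mono mult_left_mono adj_bounded bd opnorm_nonneg) auto
        finally show ?thesis
          using \<open>op_diff (adj (r n \<circ> d) \<circ> a \<circ> (r n \<circ> d)) b = adj d \<circ> D n \<circ> d\<close> by (simp add: mult_ac)
      qed
      have lower: "0 \<le> opnorm (op_diff (adj (r n \<circ> d) \<circ> a \<circ> (r n \<circ> d)) b)" for n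
        unfolding d(2)
        by (intro opnorm_nonneg bounded_op_diff bounded_op_comp adj_bounded ba br bd)
      have "(\<lambda>n. opnorm (adj d) * opnorm d * inverse (real (Suc n))) \<longlonglongrightarrow> opnorm (adj d) * opnorm d * 0"
        by (intro tendsto_mult_left LIMSEQ_inverse_real_of_nat)
      then have "(\<lambda>n. opnorm (op_diff (adj (r n \<circ> d) \<circ> a \<circ> (r n \<circ> d)) b)) \<longlonglongrightarrow> 0"
        unfolding mult_zero_right
        by (rule tendsto_sandwich[OF always_eventually always_eventually tendsto_const, OF allI allI, OF lower upper])
      moreover have "r n \<circ> d \<in> ?A" for n by (intro crossed_product_comp r d)
      ultimately show ?thesis unfolding cuntz_below_def by (intro exI[of _ "\<lambda>n. r n \<circ> d"]) simp
    qed
  qed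
  have "purely_infinite ?A"
    unfolding purely_infinite_def using no_character[OF assms(1,5) sub] cuntz by blast
  moreover have "simple_alg ?A"
    unfolding simple_alg_def
  proof (intro conjI allI impI)
    show "?A \<noteq> {op_zero}" using op_one_in op_one_neq_zero by blast
    fix J assume J: "closed_ideal ?A J"
    then have "op_zero \<in> J" by (simp add: closed_ideal_def)
    then show "J = {op_zero} \<or> J = ?A"
      using closed_ideal_eq[OF assms(5) sub J] by blast
  qed
  ultimately show ?thesis ..
qed

end
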